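(* Let $(E_6)^{\sigma}=\{\alpha\in E_6\mid \sigma\alpha\sigma=\alpha\}$ and $(E_6)^{\lambda}=\{\alpha\in E_6\mid \lambda(\alpha)=\alpha\}$. Then $$(E_6)^{\sigma}\cap (E_6)^{\lambda}\;\cong\;Spin(9).$$
   Context: Let $\mathfrak{C}$ be the division Cayley algebra (octonions), $\mathfrak{J}=\{X\in M(3,\mathfrak{C})\mid X^*=X\}$, with elements $X=\begin{pmatrix}\xi_1&x_3&\overline{x}_2\\ \overline{x}_3&\xi_2&x_1\\ x_2&\overline{x}_1&\xi_3\end{pmatrix}$, and let $\mathfrak{J}^C=\mathfrak{J}\oplus i\mathfrak{J}$ be its complexification ($C=\mathbf{R}\oplus\mathbf{R}i$), with $X\circ Y=\frac12(XY+YX)$, $(X,Y)=\mathrm{tr}(X\circ Y)$, $X\times Y=\frac12\big(2X\circ Y-\mathrm{tr}(X)Y-\mathrm{tr}(Y)X+(\mathrm{tr}(X)\mathrm{tr}(Y)-(X,Y))E\big)$, $\det X=\frac13(X,X\times X)$, complex conjugation $\tau(X+iY)=X-iY$ ($X,Y\in\mathfrak{J}$), and $\langle X,Y\rangle=(\tau X,Y)$. Then $E_6=\{\alpha\in\mathrm{Iso}_C(\mathfrak{J}^C)\mid \det\alpha X=\det X,\ \langle\alpha X,\alpha Y\rangle=\langle X,Y\rangle\}$. $\lambda$ is the involutive automorphism of $E_6$ given by $\lambda(\alpha)={}^t\alpha^{-1}=\tau\alpha\tau$ (transpose with respect to $(X,Y)$). The involutive element $\sigma\in E_6$ is the $C$-linear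 map keeping $\xi_1,\xi_2,\xi_3,x_1$ and replacing $x_2,x_3$ by $-x_2,-x_3$. *)

theory Defs
  imports "HOL-Algebra.Bij" "HOL-Analysis.Analysis"
begin

section \<open>Quaternions and Cayley algebra over a field of scalars\<close>

text \<open>
  The algebras are written over an arbitrary field of characteristic zero, so that the scalars
  \<^typ>\<open>real\<close> give the division Cayley algebra and the scalars \<^typ>\<open>complex\<close> give its
  complexification, with multiplication and conjugation extended bilinearly and linearly.
  Consequently the conjugations \<open>quat_conj\<close> and \<open>oct_conj\<close> below do not touch the scalars.

  A quaternion \<open>p\<close> has coordinates \<open>p$1, p$2, p$3, p$4\<close> with respect to \<open>1, i, j, k\<close>, where \<open>ij = k\<close>.
\<close>

definition quat_mult :: "'a::field_char_0^4 \<Rightarrow> 'a^4 \<Rightarrow> 'a^4" where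
  "quat_mult p q = vector
    [p$1 * q$1 - p$2 * q$2 - p$3 * q$3 - p$4 * q$4,
     p$1 * q$2 + p$2 * q$1 + p$3 * q$4 - p$4 * q$3,
     p$1 * q$3 - p$2 * q$4 + p$3 * q$1 + p$4 * q$2,
     p$1 * q$4 + p$2 * q$3 - p$3 * q$2 + p$4 * q$1]"

definition quat_conj :: "'a::field_char_0^4 \<Rightarrow> 'a^4" where
  "quat_conj p = vector [p$1, - p$2, - p$3, - p$4]"

text \<open>
  The pair \<open>(m, a)\<close> stands for \<open>m + a e\<^sub>4\<close> (Cayley-Dickson doubling of the quaternions).
\<close>

type_synonym 'a oct = "('a^4) \<times> ('a^4)"

fun oct_mult :: "'a::field_char_0 oct \<Rightarrow> 'a oct \<Rightarrow> 'a oct" where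
  "oct_mult (m, a) (n, b) =
    (quat_mult m n - quat_mult (quat_conj b) a, quat_mult a (quat_conj n) + quat_mult b m)"

fun oct_conj :: "'a::field_char_0 oct \<Rightarrow> 'a oct" where
  "oct_conj (m, a) = (quat_conj m, - a)"

fun oct_scale :: "'a::field_char_0 \<Rightarrow> 'a oct \<Rightarrow> 'a oct" where
  "oct_scale c (m, a) = (c *s m, c *s a)"

fun oct_scalar_part :: "'a::field_char_0 oct \<Rightarrow> 'a" where
  "oct_scalar_part (m, a) = m $ 1"

definition oct_of :: "'a::field_char_0 \<Rightarrow> 'a oct" where
  "oct_of c = (axis 1 c, 0)"


section \<open>The exceptional Jordan algebra\<close>

type_synonym 'a oct_mat = "'a oct^3^3"

definition omat_mult :: "'a::field_char_0 oct_mat \<Rightarrow> 'a oct_mat \<Rightarrow> 'a oct_mat" where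
  "omat_mult X Y = (\<chi> i j. \<Sum>k\<in>UNIV. oct_mult (X $ i $ k) (Y $ k $ j))"

definition omat_adj :: "'a::field_char_0 oct_mat \<Rightarrow> 'a oct_mat" where
  "omat_adj X = (\<chi> i j. oct_conj (X $ j $ i))"

definition omat_scale :: "'a::field_char_0 \<Rightarrow> 'a oct_mat \<Rightarrow> 'a oct_mat" where
  "omat_scale c X = (\<chi> i j. oct_scale c (X $ i $ j))"

definition omat_one :: "'a::field_char_0 oct_mat" where
  "omat_one = (\<chi> i j. if i = j then oct_of 1 else 0)"

definition jordan :: "'a::field_char_0 oct_mat set" where
  "jordan = {X. omat_adj X = X}"

abbreviation J_real :: "real oct_mat set" where
  "J_real \<equiv> jordan"

abbreviation JC :: "complex oct_mat set" where
  "JC \<equiv> jordan"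

definition jelem :: "'a::field_char_0 \<Rightarrow> 'a \<Rightarrow> 'a \<Rightarrow> 'a oct \<Rightarrow> 'a oct \<Rightarrow> 'a oct \<Rightarrow> 'a oct_mat" where
  "jelem \<xi>1 \<xi>2 \<xi>3 x1 x2 x3 = vector
    [vector [oct_of \<xi>1,   x3,           oct_conj x2],
     vector [oct_conj x3, oct_of \<xi>2,    x1],
     vector [x2,          oct_conj x1,  oct_of \<xi>3]]"

definition jmult :: "'a::field_char_0 oct_mat \<Rightarrow> 'a oct_mat \<Rightarrow> 'a oct_mat" where
  "jmult X Y = omat_scale (1/2) (omat_mult X Y + omat_mult Y X)"

text \<open>The diagonal entries of elements of \<^const>\<open>jordan\<close> are scalars; the trace is taken in the scalars.\<close>

definition jtr :: "'a::field_char_0 oct_mat \<Rightarrow> 'a" where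
  "jtr X = (\<Sum>i\<in>UNIV. oct_scalar_part (X $ i $ i))"

definition jform :: "'a::field_char_0 oct_mat \<Rightarrow> 'a oct_mat \<Rightarrow> 'a" where
  "jform X Y = jtr (jmult X Y)"

definition jcross :: "'a::field_char_0 oct_mat \<Rightarrow> 'a oct_mat \<Rightarrow> 'a oct_mat" where
  "jcross X Y = omat_scale (1/2)
    (omat_scale 2 (jmult X Y) - omat_scale (jtr X) Y - omat_scale (jtr Y) X
      + omat_scale (jtr X * jtr Y - jform X Y) omat_one)"

definition jdet :: "'a::field_char_0 oct_mat \<Rightarrow> 'a" where
  "jdet X = (1/3) * jform X (jcross X X)"


section \<open>Complex conjugation and the Hermitian inner product\<close>

definition tau :: "complex oct_mat \<Rightarrow> complex oct_mat" where
  "tau X = (\<chi> i j. map_prod (\<lambda>m. \<chi> k. cnj (m $ k)) (\<lambda>a. \<chi> k. cnj (a $ k)) (X $ i $ j))"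

definition jherm :: "complex oct_mat \<Rightarrow> complex oct_mat \<Rightarrow> complex" where
  "jherm X Y = jform (tau X) Y"

definition complexify :: "real oct_mat \<Rightarrow> complex oct_mat" where
  "complexify X =
    (\<chi> i j. map_prod (\<lambda>m. \<chi> k. complex_of_real (m $ k)) (\<lambda>a. \<chi> k. complex_of_real (a $ k)) (X $ i $ j))"


section \<open>The compact group E6, sigma and lambda\<close>

definition Iso_C :: "(complex oct_mat \<Rightarrow> complex oct_mat) set" where
  "Iso_C = {\<alpha> \<in> Bij JC.
     (\<forall>X\<in>JC. \<forall>Y\<in>JC. \<alpha> (X + Y) = \<alpha> X + \<alpha> Y) \<and>
     (\<forall>c. \<forall>X\<in>JC. \<alpha> (omat_scale c X) = omat_scale c (\<alpha> X))}"

definition E6 :: "(complex oct_mat \<Rightarrow> complex oct_mat) set" where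
  "E6 = {\<alpha> \<in> Iso_C. (\<forall>X\<in>JC. jdet (\<alpha> X) = jdet X) \<and>
                    (\<forall>X\<in>JC. \<forall>Y\<in>JC. jherm (\<alpha> X) (\<alpha> Y) = jherm X Y)}"

text \<open>
  The off-diagonal entries in the first row and the first column are \<open>x\<^sub>2\<close>, \<open>x\<^sub>3\<close> and
  their conjugates; see \<open>sigma_jelem\<close> below.
\<close>

definition sigma_map :: "complex oct_mat \<Rightarrow> complex oct_mat" where
  "sigma_map = (\<lambda>X\<in>JC. \<chi> i j. if (i = 1) = (j = 1) then X $ i $ j else - (X $ i $ j))"

text \<open>
  \<open>lambda_aut \<alpha>\<close> is \<open>\<tau>\<alpha>\<tau>\<close>; that this is the inverse transpose of \<open>\<alpha>\<close> with respect to \<^const>\<open>jform\<close>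
  is \<open>jform_lambda\<close> below.
\<close>

definition lambda_aut :: "(complex oct_mat \<Rightarrow> complex oct_mat) \<Rightarrow> complex oct_mat \<Rightarrow> complex oct_mat" where
  "lambda_aut \<alpha> = (\<lambda>X\<in>JC. tau (\<alpha> (tau X)))"

definition E6_sigma :: "(complex oct_mat \<Rightarrow> complex oct_mat) set" where
  "E6_sigma = {\<alpha> \<in> E6. compose JC sigma_map (compose JC \<alpha> sigma_map) = \<alpha>}"

definition E6_lambda :: "(complex oct_mat \<Rightarrow> complex oct_mat) set" where
  "E6_lambda = {\<alpha> \<in> E6. lambda_aut \<alpha> = \<alpha>}"


section \<open>Clifford algebra and spin group\<close>

text \<open>
  The Clifford algebra of Euclidean space with \<open>v v = -|v|\<^sup>2\<close>, in its standard basis: the set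
  \<open>{i\<^sub>1 < ... < i\<^sub>k}\<close> indexes the basis element \<open>e\<^sub>i\<^sub>1 ... e\<^sub>i\<^sub>k\<close>. Sorting the product
  \<open>e\<^sub>A e\<^sub>B\<close> requires one transposition of anticommuting generators for every pair \<open>a \<in> A\<close>,
  \<open>b \<in> B\<close> with \<open>b < a\<close>, and every common generator squares to \<open>-1\<close>.
\<close>

type_synonym 'n clifford = "real^('n set)"

definition cl_sign :: "'n::{finite,linorder} set \<Rightarrow> 'n set \<Rightarrow> real" where
  "cl_sign A B = (-1) ^ card {(a, b). a \<in> A \<and> b \<in> B \<and> b \<le> a}"

definition cl_mult :: "'n::{finite,linorder} clifford \<Rightarrow> 'n clifford \<Rightarrow> 'n clifford" where
  "cl_mult x y = (\<Sum>A\<in>UNIV. \<Sum>B\<in>UNIV. (cl_sign A B * x $ A * y $ B) *\<^sub>R axis (sym_diff A B) 1)"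

definition cl_one :: "'n::{finite,linorder} clifford" where
  "cl_one = axis {} 1"

definition cl_vec :: "real^'n::{finite,linorder} \<Rightarrow> 'n clifford" where
  "cl_vec v = (\<Sum>i\<in>UNIV. (v $ i) *\<^sub>R axis {i} 1)"

definition Spin :: "('n::{finite,linorder} clifford) monoid" where
  "Spin =
    \<lparr>carrier = {foldr cl_mult (map cl_vec vs) cl_one | vs. even (length vs) \<and> (\<forall>v\<in>set vs. norm v = 1)},
     monoid.mult = cl_mult,
     monoid.one = cl_one\<rparr>"


section \<open>Isomorphism of topological groups\<close>

text \<open>
  Both carriers have the subspace topology of their ambient types. On function types this is the
  topology of pointwise convergence, which on linear maps of a finite-dimensional space is the
  usual one.
\<close>

definition top_group_iso ::
  "('a::topological_space, 'c) monoid_scheme \<Rightarrow> ('b::topological_space, 'd) monoid_scheme \<Rightarrow> bool" where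
  "top_group_iso G H \<longleftrightarrow> group G \<and> group H \<and>
     (\<exists>f g. f \<in> iso G H \<and> homeomorphism (carrier G) (carrier H) f g)"


section \<open>Basic facts relating the definitions to their usual descriptions\<close>

lemma vector_4 [simp]:
  "(vector [x, y, z, w] :: 'a::zero^4) $ 1 = x"
  "(vector [x, y, z, w] :: 'a^4) $ 2 = y"
  "(vector [x, y, z, w] :: 'a^4) $ 3 = z"
  "(vector [x, y, z, w] :: 'a^4) $ 4 = w"
  unfolding vector_def by simp_all

lemma omat_eq_iff:
  "X = Y \<longleftrightarrow> (\<forall>i j. (\<forall>k. fst (X $ i $ j) $ k = fst (Y $ i $ j) $ k) \<and> (\<forall>k. snd (X $ i $ j) $ k = snd (Y $ i $ j) $ k))"
  for X Y :: "'a oct_mat"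
  by (auto simp: vec_eq_iff prod_eq_iff)

lemma oct_conj_eq: "oct_conj x = (quat_conj (fst x), - snd x)"
  by (cases x) simp

lemma oct_scale_eq: "oct_scale c x = (c *s fst x, c *s snd x)"
  by (cases x) simp

lemma oct_mult_eq: "oct_mult x y =
    (quat_mult (fst x) (fst y) - quat_mult (quat_conj (snd y)) (snd x),
     quat_mult (snd x) (quat_conj (fst y)) + quat_mult (snd y) (fst x))"
  by (cases x; cases y) simp

lemma oct_scalar_part_eq: "oct_scalar_part x = fst x $ 1"
  by (cases x) simp

lemma oct_conj_mult_cancel:
  "oct_mult (oct_conj x) (oct_mult x y) = oct_scale (oct_scalar_part (oct_mult (oct_conj x) x)) y"
  unfolding prod_eq_iff vec_eq_iff forall_4 oct_mult_eq oct_conj_eq oct_scale_eq oct_scalar_part_eq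
    fst_conv snd_conv quat_mult_def quat_conj_def vector_4 vector_minus_component
    vector_add_component vector_uminus_component vector_smult_component
  by (intro conjI; algebra)

lemma quat_conj_conj: "quat_conj (quat_conj p) = p"
  by (simp add: vec_eq_iff forall_4 quat_conj_def)

lemma oct_conj_conj: "oct_conj (oct_conj x) = x"
  by (simp add: oct_conj_eq quat_conj_conj)

lemma oct_conj_fixed: "oct_conj x = x \<longleftrightarrow> x = oct_of (fst x $ 1)"
  by (auto simp: oct_conj_eq oct_of_def prod_eq_iff vec_eq_iff forall_4 quat_conj_def axis_def
        neg_equal_zero eq_commute[of _ "- _"])

lemma jordan_iff_jelem: "X \<in> jordan \<longleftrightarrow> (\<exists>\<xi>1 \<xi>2 \<xi>3 x1 x2 x3. X = jelem \<xi>1 \<xi>2 \<xi>3 x1 x2 x3)"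
proof
  assume "X \<in> jordan"
  then have *: "oct_conj (X $ j $ i) = X $ i $ j" for i j
    by (simp add: jordan_def omat_adj_def vec_eq_iff)
  have "X = jelem (fst (X$1$1)$1) (fst (X$2$2)$1) (fst (X$3$3)$1) (X$2$3) (X$3$1) (X$1$2)"
    using *[of 1 1] *[of 2 2] *[of 3 3]
    by (auto simp: jelem_def vec_eq_iff[of X] vec_eq_iff[of "X $ _"] forall_3 * oct_conj_fixed[symmetric])
  then show "\<exists>\<xi>1 \<xi>2 \<xi>3 x1 x2 x3. X = jelem \<xi>1 \<xi>2 \<xi>3 x1 x2 x3" by blast
next
  assume "\<exists>\<xi>1 \<xi>2 \<xi>3 x1 x2 x3. X = jelem \<xi>1 \<xi>2 \<xi>3 x1 x2 x3"
  moreover have "oct_conj (oct_of c) = oct_of c" for c :: 'a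
    by (simp add: oct_conj_fixed) (simp add: oct_of_def)
  ultimately show "X \<in> jordan"
    by (auto simp: jordan_def omat_adj_def vec_eq_iff[of "_ :: 'a oct_mat"]
        vec_eq_iff[of "_ :: 'a oct ^ 3"] forall_3 jelem_def oct_conj_conj quat_conj_conj)
qed

lemma J_complexification:
  "bij_betw (\<lambda>(X, Y). complexify X + omat_scale \<i> (complexify Y)) (J_real \<times> J_real) JC"
proof (rule bij_betwI[where g =
    "\<lambda>Z. (\<chi> i j. map_prod (\<lambda>m. \<chi> k. Re (m $ k)) (\<lambda>a. \<chi> k. Re (a $ k)) (Z $ i $ j),
          \<chi> i j. map_prod (\<lambda>m. \<chi> k. Im (m $ k)) (\<lambda>a. \<chi> k. Im (a $ k)) (Z $ i $ j))"])
qed (auto simp: complexify_def omat_scale_def jordan_def omat_adj_def omat_eq_iff oct_scale_eq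
      oct_conj_eq quat_conj_def forall_4 complex_eq_iff)

lemma tau_complexify:
  "tau (complexify X + omat_scale \<i> (complexify Y)) = complexify X - omat_scale \<i> (complexify Y)"
  by (simp add: tau_def complexify_def omat_scale_def omat_eq_iff oct_scale_eq)

lemma sigma_jelem: "sigma_map (jelem \<xi>1 \<xi>2 \<xi>3 x1 x2 x3) = jelem \<xi>1 \<xi>2 \<xi>3 x1 (- x2) (- x3)"
proof -
  have "jelem \<xi>1 \<xi>2 \<xi>3 x1 x2 x3 \<in> JC"
    using jordan_iff_jelem by blast
  then show ?thesis
    by (simp add: sigma_map_def omat_eq_iff forall_3 forall_4 jelem_def oct_conj_eq quat_conj_def)
qed

lemma tau_jordan: "tau X \<in> JC \<longleftrightarrow> X \<in> JC"
  by (simp add: tau_def jordan_def omat_adj_def omat_eq_iff oct_conj_eq quat_conj_def forall_4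
      flip: complex_cnj_minus)

lemma tau_tau: "tau (tau X) = X"
  by (simp add: tau_def omat_eq_iff)

lemma jform_lambda:
  assumes "\<alpha> \<in> E6" "X \<in> JC" "Y \<in> JC"
  shows "jform (lambda_aut \<alpha> X) (\<alpha> Y) = jform X Y"
proof -
  have "jform (lambda_aut \<alpha> X) (\<alpha> Y) = jherm (\<alpha> (tau X)) (\<alpha> Y)"
    using assms by (simp add: lambda_aut_def jherm_def)
  also have "\<dots> = jherm (tau X) Y"
    using assms by (simp add: E6_def tau_jordan)
  finally show ?thesis
    by (simp add: jherm_def tau_tau)
qed

lemma cl_mult_nth: "cl_mult x y $ C = (\<Sum>A\<in>UNIV. cl_sign A (sym_diff A C) * x $ A * y $ sym_diff A C)"
proof -
  have "cl_mult x y $ C = (\<Sum>A\<in>UNIV. \<Sum>B\<in>UNIV. if B = sym_diff A C then cl_sign A B * x $ A * y $ B else 0)"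
    unfolding cl_mult_def sum_component
    by (intro sum.cong refl) (auto simp: axis_def)
  then show ?thesis
    by simp
qed

lemma cl_mult_axis:
  "cl_mult (axis A 1) (axis B 1) = cl_sign A B *\<^sub>R axis (sym_diff A B) 1"
proof -
  have "cl_mult (axis A 1) (axis B 1) =
     (\<Sum>A'\<in>UNIV. \<Sum>B'\<in>UNIV. if A' = A then if B' = B then cl_sign A B *\<^sub>R axis (sym_diff A B) 1 else 0 else 0)"
    unfolding cl_mult_def by (intro sum.cong refl) (auto simp: axis_def)
  also have "\<dots> = (\<Sum>A'\<in>UNIV. if A' = A then \<Sum>B'\<in>UNIV. if B' = B then cl_sign A B *\<^sub>R axis (sym_diff A B) 1 else 0 else 0)"
    by (intro sum.cong refl) simp
  finally show ?thesis by simp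
qed

lemma cl_generator_square: "cl_mult (axis {i} 1) (axis {i} 1) = - cl_one"
proof -
  have "{(a, b). a \<in> {i} \<and> b \<in> {i} \<and> b \<le> a} = {(i, i)}" by auto
  then show ?thesis by (simp add: cl_mult_axis cl_sign_def cl_one_def)
qed

lemma cl_generator_anticommute:
  assumes "i < j"
  shows "cl_mult (axis {i} 1) (axis {j} 1) = axis {i, j} 1"
    and "cl_mult (axis {j} 1) (axis {i} 1) = - axis {i, j} 1"
proof -
  have "{(a, b). a \<in> {i} \<and> b \<in> {j} \<and> b \<le> a} = {}" "{(a, b). a \<in> {j} \<and> b \<in> {i} \<and> b \<le> a} = {(j, i)}"
    "sym_diff {i} {j} = {i, j}" "sym_diff {j} {i} = {i, j}"
    using assms by auto
  then show "cl_mult (axis {i} 1) (axis {j} 1) = axis {i, j} 1"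
    and "cl_mult (axis {j} 1) (axis {i} 1) = - axis {i, j} 1"
    unfolding cl_mult_axis cl_sign_def by (simp_all only:) simp_all
qed

lemma minus_one_card_sym_diff:
  assumes "finite S" "finite T"
  shows "(-1 :: real) ^ card (sym_diff S T) = (-1) ^ card S * (-1) ^ card T"
proof -
  have "card S = card (S - T) + card (S \<inter> T)" "card T = card (T - S) + card (S \<inter> T)"
    using card_Int_Diff[OF assms(1), of T] card_Int_Diff[OF assms(2), of S] by (simp_all add: Int_commute)
  moreover have "card (sym_diff S T) = card (S - T) + card (T - S)"
    using assms by (intro card_Un_disjoint) auto
  ultimately have "card S + card T = card (sym_diff S T) + 2 * card (S \<inter> T)" by simp
  then have "(-1 :: real) ^ card S * (-1) ^ card T = (-1) ^ (card (sym_diff S T) + 2 * card (S \<inter> T))"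
    by (simp only: flip: power_add)
  then show ?thesis
    by (simp add: power_add)
qed

lemma cl_sign_sym_diff:
  "cl_sign (sym_diff A B) C = cl_sign A C * cl_sign B C"
  "cl_sign A (sym_diff B C) = cl_sign A B * cl_sign A C"
proof -
  have "{(a, b). a \<in> sym_diff A B \<and> b \<in> C \<and> b \<le> a} =
      sym_diff {(a, b). a \<in> A \<and> b \<in> C \<and> b \<le> a} {(a, b). a \<in> B \<and> b \<in> C \<and> b \<le> a}"
    "{(a, b). a \<in> A \<and> b \<in> sym_diff B C \<and> b \<le> a} =
      sym_diff {(a, b). a \<in> A \<and> b \<in> B \<and> b \<le> a} {(a, b). a \<in> A \<and> b \<in> C \<and> b \<le> a}"
    by auto
  then show "cl_sign (sym_diff A B) C = cl_sign A C * cl_sign B C"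
    "cl_sign A (sym_diff B C) = cl_sign A B * cl_sign A C"
    unfolding cl_sign_def by (simp_all only: minus_one_card_sym_diff[OF finite finite])
qed

lemma cl_mult_assoc: "cl_mult (cl_mult x y) z = cl_mult x (cl_mult y z)"
proof -
  have invol: "bij (sym_diff A)" for A :: "'n::finite set"
    by (rule involuntory_imp_bij) blast
  have "cl_mult (cl_mult x y) z $ D = cl_mult x (cl_mult y z) $ D" for D
  proof -
    define f where "f A E = cl_sign (sym_diff A E) (sym_diff (sym_diff A E) D) * (cl_sign A E * x $ A * y $ E)
        * z $ sym_diff (sym_diff A E) D" for A E
    have "cl_mult (cl_mult x y) z $ D =
      (\<Sum>A\<in>UNIV. \<Sum>C\<in>UNIV. cl_sign C (sym_diff C D) * (cl_sign A (sym_diff A C) * x $ A * y $ sym_diff A C) * z $ sym_diff C D)"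
      unfolding cl_mult_nth by (subst sum.swap) (simp add: sum_distrib_left sum_distrib_right)
    also have "\<dots> = (\<Sum>A\<in>UNIV. \<Sum>C\<in>UNIV. f A (sym_diff A C))"
    proof (intro sum.cong refl)
      fix A C :: "'a set"
      have "sym_diff A (sym_diff A C) = C" by blast
      then show "cl_sign C (sym_diff C D) * (cl_sign A (sym_diff A C) * x $ A * y $ sym_diff A C) * z $ sym_diff C D
          = f A (sym_diff A C)" by (simp only: f_def)
    qed
    also have "\<dots> = (\<Sum>A\<in>UNIV. \<Sum>E\<in>UNIV. f A E)"
      by (intro sum.cong refl sum.reindex_bij_betw[OF invol])
    also have "\<dots> = (\<Sum>A\<in>UNIV. \<Sum>E\<in>UNIV. cl_sign A (sym_diff A D) * x $ A *
        (cl_sign E (sym_diff E (sym_diff A D)) * y $ E * z $ sym_diff E (sym_diff A D)))"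
    proof (intro sum.cong refl)
      fix A E :: "'a set"
      have "sym_diff (sym_diff A E) D = sym_diff E (sym_diff A D)" by blast
      then have eq: "f A E = cl_sign (sym_diff A E) (sym_diff E (sym_diff A D)) * (cl_sign A E * x $ A * y $ E)
        * z $ sym_diff E (sym_diff A D)" by (simp only: f_def)
      define Q where "Q = sym_diff E (sym_diff A D)"
      have "cl_sign A E * cl_sign A E = 1"
        by (simp add: cl_sign_def flip: power_add)
      moreover have "cl_sign (sym_diff A E) Q = cl_sign A Q * cl_sign E Q"
        "cl_sign A Q = cl_sign A E * cl_sign A (sym_diff A D)"
        unfolding Q_def by (rule cl_sign_sym_diff)+
      ultimately have "cl_sign (sym_diff A E) Q * cl_sign A E = cl_sign A (sym_diff A D) * cl_sign E Q"
        by algebra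
      then have "cl_sign (sym_diff A E) Q * (cl_sign A E * x $ A * y $ E) * z $ Q =
          cl_sign A (sym_diff A D) * x $ A * (cl_sign E Q * y $ E * z $ Q)"
        by algebra
      then show "f A E = cl_sign A (sym_diff A D) * x $ A *
        (cl_sign E (sym_diff E (sym_diff A D)) * y $ E * z $ sym_diff E (sym_diff A D))"
        unfolding eq Q_def .
    qed
    also have "\<dots> = cl_mult x (cl_mult y z) $ D"
      unfolding cl_mult_nth by (simp only: sum_distrib_left)
    finally show ?thesis .
  qed
  then show ?thesis by (simp add: vec_eq_iff)
qed

end

theory Submission
  imports Defs
begin

text \<open>
  In the Peirce decomposition with respect to the first idempotent, an element of the complexified
  Jordan algebra is \<open>(r, p, w, s)\<close> with \<open>w = ((\<xi>\<^sub>2 - \<xi>\<^sub>3)/2, x\<^sub>1)\<close> in a 9-dimensional space and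
  \<open>s = (x\<^sub>2, x\<^sub>3)\<close> in a 16-dimensional one, and
  \<open>det = r (p\<^sup>2 - (w, w)) - p (s, s) + (clif w s, s)\<close>, where \<open>clif w\<close> is symmetric with square
  \<open>(w, w)\<close>. So \<open>\<i> clif\<close> makes the \<open>s\<close> into a module of the Clifford algebra, and \<open>x \<in> Spin\<close> acts by
  \<open>(r, p, w, s) \<mapsto> (r, p, x w x\<^sup>-\<^sup>1, x s)\<close>. Conversely, an element \<open>\<alpha>\<close> fixed by \<open>\<sigma>\<close> and \<open>\<lambda>\<close> is real and
  preserves the splitting into \<open>(r, p, w)\<close> and \<open>s\<close>; invariance of the determinant and of the
  bilinear form forces \<open>\<alpha> (r, p, w, s) = (r, p, A w, B s)\<close> with \<open>A\<close> orthogonal and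
  \<open>B (clif w s) = clif (A w) (B s)\<close>. Write \<open>A\<close> as a product of reflections in unit vectors and let
  \<open>x\<close> be their Clifford product. Then \<open>x\<^sup>-\<^sup>1 B\<close> commutes or anticommutes with \<open>clif\<close>, according to
  the parity of the number of reflections; by Schur's lemma the second case is impossible and in the
  first case \<open>B = \<plusminus> x\<close>.
\<close>

section \<open>Clifford algebra and spin group\<close>

interpretation cl_mult: bounded_bilinear "cl_mult :: 'n::{finite,linorder} clifford \<Rightarrow> _"
proof -
  have "bilinear (cl_mult :: 'n clifford \<Rightarrow> _)"
    unfolding bilinear_def
    by (auto intro!: linearI simp: vec_eq_iff cl_mult_nth algebra_simps sum.distrib sum_distrib_left)
  then show "bounded_bilinear (cl_mult :: 'n clifford \<Rightarrow> _)"
    by (simp add: bilinear_conv_bounded_bilinear)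
qed

section \<open>Signs of basis products, the unit and the inverting anti-automorphism\<close>

lemma cl_sign_empty [simp]: "cl_sign {} A = 1" "cl_sign A {} = 1"
  by (simp_all add: cl_sign_def)

lemma cl_sign_mult_self [simp]: "cl_sign A B * cl_sign A B = 1"
  by (simp add: cl_sign_def flip: power_add)

lemma cl_sign_neq_0 [simp]: "cl_sign A B \<noteq> 0"
  by (simp add: cl_sign_def)

lemma cl_sign_Un:
  assumes "A \<inter> B = {}"
  shows "cl_sign (A \<union> B) C = cl_sign A C * cl_sign B C" "cl_sign C (A \<union> B) = cl_sign C A * cl_sign C B"
proof -
  have "sym_diff A B = A \<union> B" using assms by blast
  then show "cl_sign (A \<union> B) C = cl_sign A C * cl_sign B C" "cl_sign C (A \<union> B) = cl_sign C A * cl_sign C B"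
    using cl_sign_sym_diff[of A B C] cl_sign_sym_diff(2)[of C A B] by simp_all
qed

lemma cl_sign_singletons: "cl_sign {i} {j} = (if j \<le> i then -1 else 1)"
proof -
  have "{(a, b). a \<in> {i} \<and> b \<in> {j} \<and> b \<le> a} = (if j \<le> i then {(i, j)} else {})" by auto
  then show ?thesis by (simp add: cl_sign_def)
qed

lemma sym_diff_involutive: "sym_diff (sym_diff B C) C = B" "sym_diff C (sym_diff C B) = B"
  by blast+

lemma bij_sym_diff: "bij (\<lambda>A. sym_diff A C)"
  by (rule involuntory_imp_bij) blast

lemma cl_one_left [simp]: "cl_mult cl_one x = x"
proof -
  have "cl_mult cl_one x $ C = (\<Sum>A\<in>UNIV. if A = ({} :: 'a set) then x $ C else 0)" for C
    unfolding cl_mult_nth cl_one_def by (intro sum.cong refl) (auto simp: axis_def)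
  then show ?thesis by (simp add: vec_eq_iff)
qed

lemma cl_one_right [simp]: "cl_mult x cl_one = x"
proof -
  have "cl_mult x cl_one $ C = (\<Sum>A\<in>UNIV. if A = C then x $ C else 0)" for C
    unfolding cl_mult_nth cl_one_def
  proof (intro sum.cong refl)
    fix A :: "'a set"
    have "(sym_diff A C = {}) = (A = C)" by blast
    then show "cl_sign A (sym_diff A C) * x $ A * axis {} 1 $ sym_diff A C = (if A = C then x $ C else 0)"
      by (auto simp: axis_def)
  qed
  then show ?thesis by (simp add: vec_eq_iff)
qed

lemma axis_expansion: "(x :: real^'n) = (\<Sum>A\<in>UNIV. x $ A *\<^sub>R axis A (1::real))"
  by (simp add: vec_eq_iff axis_def if_distrib cong: if_cong)

text \<open>The linear extension of \<open>e\<^sub>A \<mapsto> e\<^sub>A\<^sup>-\<^sup>1\<close>.\<close>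

definition cl_star :: "'n::{finite,linorder} clifford \<Rightarrow> 'n clifford" where
  "cl_star x = (\<chi> A. cl_sign A A * x $ A)"

lemma cl_star_axis: "cl_star (axis A 1) = cl_sign A A *\<^sub>R axis A 1"
  by (simp add: cl_star_def vec_eq_iff axis_def)

lemma linear_cl_star: "linear cl_star"
  by (auto intro!: linearI simp: cl_star_def vec_eq_iff algebra_simps)

lemma cl_star_cl_one [simp]: "cl_star cl_one = cl_one"
  by (simp add: cl_star_axis cl_one_def)

lemma cl_vec_nth: "cl_vec v $ A = (\<Sum>i\<in>UNIV. if A = {i} then v $ i else 0)"
  by (simp add: cl_vec_def axis_def if_distrib cong: if_cong)

lemma cl_vec_nth_singleton [simp]: "cl_vec v $ {i} = v $ i"
  by (simp add: cl_vec_nth)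

lemma linear_cl_vec: "linear cl_vec"
  by (auto intro!: linearI simp: cl_vec_def algebra_simps sum.distrib scaleR_sum_right)

lemma cl_star_cl_vec [simp]: "cl_star (cl_vec v) = - cl_vec v"
proof -
  have "cl_star (cl_vec v) = (\<Sum>i\<in>UNIV. v $ i *\<^sub>R cl_star (axis {i} 1))"
    unfolding cl_vec_def by (simp add: linear_sum[OF linear_cl_star] linear_scale[OF linear_cl_star])
  then show ?thesis
    by (simp add: cl_star_axis cl_sign_singletons cl_vec_def sum_negf)
qed

text \<open>Inverting basis elements reverses their products. In coordinates, after reindexing by
  \<open>sym_diff A C\<close>, this is an identity of signs that follows from \<open>cl_sign\<close>
  being multiplicative under symmetric difference in both arguments and from signs squaring to
  1.\<close>

lemma cl_star_mult: "cl_star (cl_mult x y) = cl_mult (cl_star y) (cl_star x)"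
proof -
  have "cl_star (cl_mult x y) $ C = cl_mult (cl_star y) (cl_star x) $ C" for C
  proof -
    have "cl_mult (cl_star y) (cl_star x) $ C =
      (\<Sum>A\<in>UNIV. cl_sign (sym_diff A C) A * (cl_sign (sym_diff A C) (sym_diff A C) * y $ sym_diff A C)
        * (cl_sign A A * x $ A))"
      unfolding cl_mult_nth cl_star_def vec_lambda_beta
      by (subst sum.reindex_bij_betw[OF bij_sym_diff[of C], symmetric]) (simp add: sym_diff_involutive)
    also have "\<dots> = (\<Sum>A\<in>UNIV. cl_sign C C * (cl_sign A (sym_diff A C) * x $ A * y $ sym_diff A C))"
    proof (intro sum.cong refl)
      fix A :: "'a set"
      have sq: "cl_sign A A * cl_sign A A = 1" "cl_sign C A * cl_sign C A = 1" by simp_all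
      have "cl_sign (sym_diff A C) A * cl_sign (sym_diff A C) (sym_diff A C) * cl_sign A A
          = cl_sign C C * cl_sign A (sym_diff A C)"
        unfolding cl_sign_sym_diff using sq by algebra
      then show "cl_sign (sym_diff A C) A * (cl_sign (sym_diff A C) (sym_diff A C) * y $ sym_diff A C)
        * (cl_sign A A * x $ A) = cl_sign C C * (cl_sign A (sym_diff A C) * x $ A * y $ sym_diff A C)"
        by algebra
    qed
    finally show ?thesis
      by (simp add: cl_star_def cl_mult_nth sum_distrib_left)
  qed
  then show ?thesis by (simp add: vec_eq_iff)
qed

section \<open>Clifford relations, products of vectors and the group structure of Spin\<close>

lemma cl_generators_anticommutator:
  "cl_mult (axis {i} 1) (axis {j} 1) + cl_mult (axis {j} 1) (axis {i} 1)
    = (if i = j then -2 else 0) *\<^sub>R cl_one"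
proof (cases i j rule: linorder_cases)
  case equal
  then show ?thesis by (simp add: cl_generator_square scaleR_2[symmetric])
qed (use cl_generator_anticommute[of i j] cl_generator_anticommute[of j i] in \<open>auto simp: insert_commute\<close>)

lemma cl_vec_anticommutator:
  "cl_mult (cl_vec v) (cl_vec w) + cl_mult (cl_vec w) (cl_vec v) = (- 2 * (v \<bullet> w)) *\<^sub>R cl_one"
proof -
  have e: "cl_mult (cl_vec v) (cl_vec w) = (\<Sum>i\<in>UNIV. \<Sum>j\<in>UNIV. (v $ i * w $ j) *\<^sub>R cl_mult (axis {i} 1) (axis {j} 1))"
    for v w :: "(real, 'a) vec"
    unfolding cl_vec_def cl_mult.sum_left cl_mult.sum_right cl_mult.scaleR_left cl_mult.scaleR_right
    by (subst sum.swap) (simp add: scaleR_sum_right mult.commute)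
  have "cl_mult (cl_vec v) (cl_vec w) + cl_mult (cl_vec w) (cl_vec v) =
    (\<Sum>i\<in>UNIV. \<Sum>j\<in>UNIV. (v $ i * w $ j) *\<^sub>R (cl_mult (axis {i} 1) (axis {j} 1) + cl_mult (axis {j} 1) (axis {i} 1)))"
    unfolding e[of v w] e[of w v] by (subst (2) sum.swap) (simp add: sum.distrib algebra_simps)
  also have "\<dots> = (\<Sum>i\<in>UNIV. \<Sum>j\<in>UNIV. if i = j then (- 2 * (v $ i * w $ i)) *\<^sub>R cl_one else 0)"
    unfolding cl_generators_anticommutator by (intro sum.cong refl) auto
  also have "\<dots> = (- 2 * (v \<bullet> w)) *\<^sub>R cl_one"
    by (simp add: inner_vec_def scaleR_sum_left sum_distrib_left sum_negf mult.assoc)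
  finally show ?thesis .
qed

lemma cl_vec_square: "cl_mult (cl_vec v) (cl_vec v) = - (v \<bullet> v) *\<^sub>R cl_one"
proof -
  have "2 *\<^sub>R cl_mult (cl_vec v) (cl_vec v) = 2 *\<^sub>R (- (v \<bullet> v) *\<^sub>R cl_one)"
    using cl_vec_anticommutator[of v v] by (simp add: scaleR_2)
  then show ?thesis by (subst (asm) scaleR_cancel_left) simp
qed

definition cl_prod :: "(real^'n::{finite,linorder}) list \<Rightarrow> 'n clifford" where
  "cl_prod vs = foldr cl_mult (map cl_vec vs) cl_one"

lemma cl_prod_simps [simp]: "cl_prod [] = cl_one" "cl_prod (v # vs) = cl_mult (cl_vec v) (cl_prod vs)"
  by (simp_all add: cl_prod_def)

lemma cl_prod_append: "cl_prod (us @ vs) = cl_mult (cl_prod us) (cl_prod vs)"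
  by (induction us) (simp_all add: cl_mult_assoc)

lemma cl_star_cl_prod: "cl_star (cl_prod vs) = (-1) ^ length vs *\<^sub>R cl_prod (rev vs)"
  by (induction vs) (simp_all add: cl_star_mult cl_prod_append cl_mult.scaleR_left cl_mult.minus_right)

text \<open>A unit vector v satisfies v v = -1, so its inverse is -v, which is
  \<open>cl_star\<close> of it; this passes to products of either parity.\<close>

lemma cl_star_cl_prod_unit:
  fixes vs :: "(real, 'n::{finite,linorder}) vec list"
  assumes "\<forall>v\<in>set vs. norm v = 1"
  shows "cl_mult (cl_star (cl_prod vs)) (cl_prod vs) = cl_one"
    and "cl_mult (cl_prod vs) (cl_star (cl_prod vs)) = cl_one"
proof -
  have unit: "cl_mult (- cl_vec v) (cl_mult (cl_vec v) x) = x" "cl_mult (cl_vec v) (cl_mult (- cl_vec v) x) = x"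
    if "norm v = 1" for v :: "(real, 'n) vec" and x
    using that unfolding cl_mult_assoc[symmetric] cl_mult.minus_left cl_mult.minus_right cl_vec_square
    by (simp_all add: norm_eq_1 cl_mult.minus_left)
  show "cl_mult (cl_star (cl_prod vs)) (cl_prod vs) = cl_one"
    using assms by (induction vs) (simp_all add: cl_star_mult cl_mult_assoc unit)
  show "cl_mult (cl_prod vs) (cl_star (cl_prod vs)) = cl_one"
    using assms
  proof (induction vs)
    case (Cons v vs)
    have "cl_mult (cl_prod (v # vs)) (cl_star (cl_prod (v # vs)))
      = cl_mult (cl_vec v) (cl_mult (cl_mult (cl_prod vs) (cl_star (cl_prod vs))) (- cl_vec v))"
      by (simp add: cl_star_mult cl_mult_assoc)
    then show ?case using Cons unit(2)[of v cl_one] by simp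
  qed simp
qed

lemma carrier_Spin: "x \<in> carrier Spin \<longleftrightarrow> (\<exists>vs. x = cl_prod vs \<and> even (length vs) \<and> (\<forall>v\<in>set vs. norm v = 1))"
  by (simp add: Spin_def cl_prod_def)

lemma Spin_simps [simp]: "monoid.mult Spin = cl_mult" "monoid.one Spin = cl_one"
  by (simp_all add: Spin_def)

lemma Spin_star:
  assumes "x \<in> carrier Spin"
  shows "cl_star x \<in> carrier Spin" "cl_mult (cl_star x) x = cl_one" "cl_mult x (cl_star x) = cl_one"
proof -
  obtain vs where vs: "x = cl_prod vs" "even (length vs)" "\<forall>v\<in>set vs. norm v = 1"
    using assms carrier_Spin by blast
  then show "cl_mult (cl_star x) x = cl_one" "cl_mult x (cl_star x) = cl_one"
    using cl_star_cl_prod_unit by blast+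
  have "cl_star x = cl_prod (rev vs)" using vs by (simp add: cl_star_cl_prod)
  then show "cl_star x \<in> carrier Spin" unfolding carrier_Spin using vs
    by (intro exI[of _ "rev vs"]) simp
qed

lemma group_Spin: "group (Spin :: ('n::{finite,linorder} clifford) monoid)"
proof (rule groupI)
  fix x y :: "'n clifford"
  assume "x \<in> carrier Spin" "y \<in> carrier Spin"
  then obtain us vs where *: "x = cl_prod us" "even (length us)" "\<forall>v\<in>set us. norm v = 1"
    "y = cl_prod vs" "even (length vs)" "\<forall>v\<in>set vs. norm v = 1"
    unfolding carrier_Spin by blast
  have "x \<otimes>\<^bsub>Spin\<^esub> y = cl_prod (us @ vs)"
    by (simp add: * cl_prod_append)
  then show "x \<otimes>\<^bsub>Spin\<^esub> y \<in> carrier Spin"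
    unfolding carrier_Spin using * by (intro exI[of _ "us @ vs"]) auto
next
  show "\<one>\<^bsub>Spin\<^esub> \<in> carrier (Spin :: 'n clifford monoid)"
    unfolding carrier_Spin by (intro exI[of _ "[]"]) simp
next
  fix x :: "'n clifford"
  assume "x \<in> carrier Spin"
  then show "\<exists>y\<in>carrier Spin. y \<otimes>\<^bsub>Spin\<^esub> x = \<one>\<^bsub>Spin\<^esub>"
    using Spin_star(1,2)[of x] by auto
qed (simp_all add: cl_mult_assoc)

section \<open>Even elements and the recovery of coefficients by averaging\<close>

lemma even_card_sym_diff: "even (card (sym_diff A B)) = (even (card A) = even (card B))"
  if "finite A" "finite B"
  using minus_one_card_sym_diff[OF that] by (auto simp: minus_one_power_iff split: if_splits)

definition cl_even :: "'n::{finite,linorder} clifford \<Rightarrow> bool" where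
  "cl_even x \<longleftrightarrow> (\<forall>A. x $ A \<noteq> 0 \<longrightarrow> even (card A))"

lemma cl_mult_nth_neq_0:
  assumes "cl_mult x y $ C \<noteq> 0"
  obtains A where "x $ A \<noteq> 0" "y $ sym_diff A C \<noteq> 0"
proof -
  from assms obtain A where "cl_sign A (sym_diff A C) * x $ A * y $ sym_diff A C \<noteq> 0"
    unfolding cl_mult_nth by (rule sum.not_neutral_contains_not_neutral)
  then show ?thesis by (intro that[of A]) auto
qed

lemma cl_even_mult:
  assumes "cl_even x" "cl_even y"
  shows "cl_even (cl_mult x y)"
  unfolding cl_even_def
proof (intro allI impI)
  fix C assume "cl_mult x y $ C \<noteq> 0"
  then obtain A where "x $ A \<noteq> 0" "y $ sym_diff A C \<noteq> 0"
    by (rule cl_mult_nth_neq_0)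
  then have "even (card A)" "even (card (sym_diff A C))"
    using assms by (auto simp: cl_even_def)
  then show "even (card C)" by (simp add: even_card_sym_diff)
qed

lemma cl_even_vec_vec:
  fixes u v :: "(real, 'n::{finite,linorder}) vec"
  shows "cl_even (cl_mult (cl_vec u) (cl_vec v))"
  unfolding cl_even_def
proof (intro allI impI)
  fix C assume "cl_mult (cl_vec u) (cl_vec v) $ C \<noteq> 0"
  then obtain A where "cl_vec u $ A \<noteq> 0" "cl_vec v $ sym_diff A C \<noteq> 0"
    by (rule cl_mult_nth_neq_0)
  moreover have "card A = 1" if "cl_vec w $ A \<noteq> 0" for w :: "(real, 'n) vec" and A
  proof -
    from that obtain i where "(if A = {i} then w $ i else 0) \<noteq> 0"
      unfolding cl_vec_nth by (rule sum.not_neutral_contains_not_neutral)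
    then show ?thesis by (auto split: if_splits)
  qed
  ultimately have "odd (card A)" "odd (card (sym_diff A C))" by simp_all
  then show "even (card C)" by (simp add: even_card_sym_diff)
qed

lemma cl_even_Spin:
  assumes "x \<in> carrier Spin"
  shows "cl_even x"
proof -
  obtain vs where vs: "x = cl_prod vs" "even (length vs)"
    using assms carrier_Spin by blast
  have "cl_even (cl_prod vs)" using vs(2)
  proof (induction vs rule: induct_list012)
    case (3 u v vs)
    then show ?case using cl_even_mult[OF cl_even_vec_vec, of "cl_prod vs" u v] by (simp add: cl_mult_assoc)
  qed (auto simp: cl_even_def cl_one_def axis_def)
  then show ?thesis by (simp add: vs)
qed

text \<open>For even nonempty \<open>B\<close>, conjugation by the \<open>e\<^sub>C\<close> multiplies \<open>e\<^sub>B\<close> by a nontrivial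
  character in \<open>C\<close>, so averaging over \<open>C\<close> leaves only the scalar part.\<close>

lemma cl_average:
  assumes "cl_even x"
  shows "(\<Sum>C\<in>UNIV. cl_mult (axis C 1) (cl_mult x (cl_star (axis C 1))))
    = (2 ^ CARD('n) * x $ {}) *\<^sub>R (cl_one :: 'n::{finite,linorder} clifford)"
proof -
  define c where "c B C = cl_sign C B * cl_sign B C" for B C :: "'n set"
  have conj: "cl_mult (axis C 1) (cl_mult (axis B 1) (cl_star (axis C 1))) = c B C *\<^sub>R axis B 1" for B C :: "'n set"
  proof -
    have "cl_sign C C * cl_sign C C = 1" by simp
    then have "cl_sign C C * (cl_sign C B * cl_sign (sym_diff C B) C) = c B C"
      unfolding cl_sign_sym_diff c_def by algebra
    moreover have "sym_diff (sym_diff C B) C = B" by blast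
    ultimately show ?thesis
      by (subst cl_mult_assoc[symmetric])
        (simp only: cl_star_axis cl_mult.scaleR_right cl_mult_axis cl_mult.scaleR_left scaleR_scaleR)
  qed
  have sum_c: "(\<Sum>C\<in>UNIV. c B C) = 0" if B: "even (card B)" "B \<noteq> {}" for B
  proof -
    \<comment> \<open>Together the two signs count every element of B once and i twice, so
      \<open>c B {i}\<close> has the odd exponent \<open>card B + 1\<close>. Shifting the summation
      by \<open>{i}\<close> then negates the sum.\<close>
    obtain i where i: "i \<in> B" using B by blast
    have "{(a, b). a \<in> {i} \<and> b \<in> B \<and> b \<le> a} = Pair i ` {b\<in>B. b \<le> i}"
      "{(a, b). a \<in> B \<and> b \<in> {i} \<and> b \<le> a} = (\<lambda>a. (a, i)) ` {b\<in>B. i \<le> b}" by auto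
    then have "c B {i} = (-1) ^ (card {b\<in>B. b \<le> i} + card {b\<in>B. i \<le> b})"
      unfolding c_def cl_sign_def by (simp add: card_image inj_on_def power_add)
    also have "card {b\<in>B. b \<le> i} + card {b\<in>B. i \<le> b} = card ({b\<in>B. b \<le> i} \<union> {b\<in>B. i \<le> b}) + card ({b\<in>B. b \<le> i} \<inter> {b\<in>B. i \<le> b})"
      by (rule card_Un_Int) simp_all
    also have "{b\<in>B. b \<le> i} \<union> {b\<in>B. i \<le> b} = B" by auto
    also have "{b\<in>B. b \<le> i} \<inter> {b\<in>B. i \<le> b} = {i}" using i by auto
    finally have ci: "c B {i} = -1" using B by simp
    have "(\<Sum>C\<in>UNIV. c B C) = (\<Sum>C\<in>UNIV. c B (sym_diff C {i}))"
      by (rule sum.reindex_bij_betw[OF bij_sym_diff, symmetric])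
    also have "\<dots> = (\<Sum>C\<in>UNIV. - c B C)"
    proof (intro sum.cong refl)
      fix C
      have "c B (sym_diff C {i}) = c B C * c B {i}"
        unfolding c_def cl_sign_sym_diff by algebra
      then show "c B (sym_diff C {i}) = - c B C" using ci by simp
    qed
    finally show ?thesis by (simp add: sum_negf)
  qed
  have "(\<Sum>C\<in>UNIV. cl_mult (axis C 1) (cl_mult x (cl_star (axis C 1))))
    = (\<Sum>C\<in>UNIV. \<Sum>B\<in>UNIV. (x $ B * c B C) *\<^sub>R axis B 1)"
    by (subst axis_expansion[of x])
      (simp add: cl_mult.sum_left cl_mult.sum_right cl_mult.scaleR_left cl_mult.scaleR_right conj)
  also have "\<dots> = (\<Sum>B\<in>UNIV. (x $ B * (\<Sum>C\<in>UNIV. c B C)) *\<^sub>R axis B 1)"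
    by (subst sum.swap) (simp add: scaleR_sum_left sum_distrib_left)
  also have "\<dots> = (\<Sum>B\<in>UNIV. if B = ({} :: 'n set) then (x $ {} * 2 ^ CARD('n)) *\<^sub>R axis {} 1 else 0)"
  proof (intro sum.cong refl)
    fix B :: "'n set"
    have "x $ B = 0 \<or> (\<Sum>C\<in>UNIV. c B C) = 0" if "B \<noteq> {}"
      using assms sum_c that unfolding cl_even_def by blast
    moreover have "(\<Sum>C\<in>(UNIV :: 'n set set). c {} C) = 2 ^ CARD('n)"
      unfolding c_def by (simp flip: Pow_UNIV add: card_Pow)
    ultimately show "(x $ B * (\<Sum>C\<in>UNIV. c B C)) *\<^sub>R axis B 1
      = (if B = {} then (x $ {} * 2 ^ CARD('n)) *\<^sub>R axis {} 1 else (0 :: 'n clifford))" by auto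
  qed
  finally show ?thesis by (simp add: cl_one_def mult.commute)
qed

lemma cl_star_axis_mult_nth: "cl_mult (cl_star (axis A 1)) x $ {} = x $ A"
proof -
  have "cl_mult (cl_star (axis A 1)) x $ {} = (\<Sum>B\<in>UNIV. if B = A then x $ A else 0)"
    unfolding cl_mult_nth by (intro sum.cong refl) (auto simp: cl_star_def axis_def)
  then show ?thesis by simp
qed

text \<open>Multiplication by the inverse of the basis element for A moves its coefficient to the
  scalar position, where the average picks it out.\<close>

lemma cl_average_coefficient:
  fixes x :: "'n::{finite,linorder} clifford"
  assumes "cl_even x" "even (card A)"
  shows "(\<Sum>C\<in>UNIV. cl_mult (axis C 1) (cl_mult (cl_mult (cl_star (axis A 1)) x) (cl_star (axis C 1))))
    = (2 ^ CARD('n) * x $ A) *\<^sub>R cl_one"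
proof -
  have "cl_even (cl_star (axis A 1))"
    using assms by (auto simp: cl_even_def cl_star_def axis_def)
  from cl_average[OF cl_even_mult[OF this assms(1)]] show ?thesis
    by (simp add: cl_star_axis_mult_nth)
qed

text \<open>On a product of \<open>k\<close> unit vectors this is \<open>(-1)\<^sup>k\<close> times the product of the
  reflections in them, because \<open>u w u\<^sup>-\<^sup>1 = - (w - 2 (u \<bullet> w) u)\<close> for a unit vector \<open>u\<close>.\<close>

definition cl_ad :: "'n::{finite,linorder} clifford \<Rightarrow> (real, 'n) vec \<Rightarrow> (real, 'n) vec" where
  "cl_ad x w = (\<chi> i. cl_mult (cl_mult x (cl_vec w)) (cl_star x) $ {i})"

section \<open>Reflections and the conjugation action on vectors\<close>

definition reflect :: "'a::real_inner \<Rightarrow> 'a \<Rightarrow> 'a" where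
  "reflect u w = w - (2 * (u \<bullet> w)) *\<^sub>R u"

lemma linear_reflect: "linear (reflect u)"
  by (auto intro!: linearI simp: reflect_def inner_add_right algebra_simps)

lemma cl_vec_conj_unit:
  assumes "norm u = 1"
  shows "cl_mult (cl_mult (cl_vec u) (cl_vec w)) (cl_star (cl_vec u)) = - cl_vec (reflect u w)"
proof -
  have "cl_mult (cl_vec u) (cl_vec w) = (- 2 * (u \<bullet> w)) *\<^sub>R cl_one - cl_mult (cl_vec w) (cl_vec u)"
    using cl_vec_anticommutator[of u w] by (simp add: algebra_simps)
  then have "cl_mult (cl_mult (cl_vec u) (cl_vec w)) (cl_star (cl_vec u))
    = (2 * (u \<bullet> w)) *\<^sub>R cl_vec u + cl_mult (cl_vec w) (cl_mult (cl_vec u) (cl_vec u))"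
    by (simp add: cl_mult.minus_right cl_mult.minus_left cl_mult.diff_left cl_mult.scaleR_left cl_mult_assoc)
  also have "\<dots> = - cl_vec (reflect u w)"
    using assms by (simp add: cl_vec_square norm_eq_1 cl_mult.minus_right reflect_def
      linear_diff[OF linear_cl_vec] linear_scale[OF linear_cl_vec])
  finally show ?thesis .
qed

lemma cl_prod_conj:
  assumes "\<forall>v\<in>set vs. norm v = 1"
  shows "cl_mult (cl_mult (cl_prod vs) (cl_vec w)) (cl_star (cl_prod vs))
    = (-1) ^ length vs *\<^sub>R cl_vec (foldr reflect vs w)"
  using assms
proof (induction vs)
  case (Cons v vs)
  have "cl_mult (cl_mult (cl_prod (v # vs)) (cl_vec w)) (cl_star (cl_prod (v # vs)))
    = cl_mult (cl_mult (cl_vec v) (cl_mult (cl_mult (cl_prod vs) (cl_vec w)) (cl_star (cl_prod vs)))) (cl_star (cl_vec v))"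
    by (simp add: cl_star_mult cl_mult_assoc)
  also have "\<dots> = (-1) ^ length vs *\<^sub>R cl_mult (cl_mult (cl_vec v) (cl_vec (foldr reflect vs w))) (cl_star (cl_vec v))"
    using Cons by (simp del: cl_star_cl_vec add: cl_mult.scaleR_left cl_mult.scaleR_right)
  also have "\<dots> = (-1) ^ length (v # vs) *\<^sub>R cl_vec (foldr reflect (v # vs) w)"
    using Cons.prems by (simp del: cl_star_cl_vec add: cl_vec_conj_unit)
  finally show ?case .
qed simp

text \<open>Conjugation by a spin element maps vectors to vectors, so nothing is lost when
  \<open>cl_ad\<close> reads off the coefficients of the singletons only.\<close>

lemma cl_vec_cl_ad:
  assumes "x \<in> carrier Spin"
  shows "cl_mult (cl_mult x (cl_vec w)) (cl_star x) = cl_vec (cl_ad x w)"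
proof -
  obtain vs where vs: "x = cl_prod vs" "even (length vs)" "\<forall>v\<in>set vs. norm v = 1"
    using assms carrier_Spin by blast
  then have e: "cl_mult (cl_mult x (cl_vec w)) (cl_star x) = cl_vec (foldr reflect vs w)"
    using cl_prod_conj[OF vs(3)] by simp
  then have "cl_ad x w = foldr reflect vs w" by (simp add: cl_ad_def vec_eq_iff)
  then show ?thesis using e by simp
qed

lemma linear_cl_ad: "linear (cl_ad x)"
  by (auto intro!: linearI simp: cl_ad_def vec_eq_iff linear_add[OF linear_cl_vec] linear_scale[OF linear_cl_vec]
     cl_mult.add_left cl_mult.add_right cl_mult.scaleR_left cl_mult.scaleR_right)

lemma cl_vec_inject: "cl_vec v = cl_vec w \<Longrightarrow> v = w"
  by (metis cl_vec_nth_singleton vec_eq_iff)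

lemma cl_ad_mult:
  assumes "x \<in> carrier Spin" "y \<in> carrier Spin"
  shows "cl_ad (cl_mult x y) w = cl_ad x (cl_ad y w)"
proof -
  have "cl_mult (cl_mult (cl_mult x y) (cl_vec w)) (cl_star (cl_mult x y))
      = cl_mult (cl_mult x (cl_mult (cl_mult y (cl_vec w)) (cl_star y))) (cl_star x)"
    by (simp add: cl_star_mult cl_mult_assoc)
  also have "\<dots> = cl_vec (cl_ad x (cl_ad y w))"
    by (simp only: cl_vec_cl_ad assms)
  finally show ?thesis
    unfolding cl_ad_def[of "cl_mult x y"] by (simp add: vec_eq_iff)
qed

lemma inner_reflect:
  assumes "norm u = 1"
  shows "reflect u v \<bullet> reflect u w = v \<bullet> w"
  using assms inner_commute[of v u]
  by (simp add: reflect_def inner_diff_left inner_diff_right norm_eq_1)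

lemma inner_cl_ad:
  assumes "x \<in> carrier Spin"
  shows "cl_ad x v \<bullet> cl_ad x w = v \<bullet> w"
proof -
  obtain vs where vs: "x = cl_prod vs" "even (length vs)" "\<forall>v\<in>set vs. norm v = 1"
    using assms carrier_Spin by blast
  then have "cl_mult (cl_mult x (cl_vec w)) (cl_star x) = cl_vec (foldr reflect vs w)" for w
    using cl_prod_conj[OF vs(3)] by simp
  then have ad: "cl_ad x w = foldr reflect vs w" for w by (simp add: cl_ad_def vec_eq_iff)
  show ?thesis unfolding ad using vs(3) by (induction vs) (simp_all add: inner_reflect)
qed

section \<open>Orthogonal maps are products of reflections\<close>

lemma reflect_reflect: "norm u = 1 \<Longrightarrow> reflect u (reflect u w) = w"
  by (simp add: reflect_def inner_diff_right norm_eq_1 algebra_simps)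

text \<open>Induction on a set T of coordinates outside which f fixes the standard basis. If f moves
  e_i, the reflection in f e_i - e_i sends f e_i back to e_i, and it fixes every e_j that f fixes,
  because such an e_j is orthogonal to f e_i - e_i.\<close>

lemma orthogonal_product_of_reflections:
  fixes f :: "real^'n \<Rightarrow> real^'n"
  assumes "orthogonal_transformation f"
  shows "\<exists>vs. (\<forall>v\<in>set vs. norm v = 1) \<and> f = foldr reflect vs"
proof -
  have "\<exists>vs. (\<forall>v\<in>set vs. norm v = 1) \<and> f = foldr reflect vs"
    if "orthogonal_transformation f" "\<forall>i. i \<notin> T \<longrightarrow> f (axis i 1) = axis i 1" "finite T"
    for T and f :: "real^'n \<Rightarrow> real^'n"
    using that(3,1,2)
  proof (induction T arbitrary: f rule: finite_induct)
    case empty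
    then have lin: "linear f" by (simp add: orthogonal_transformation_def)
    have "f x = x" for x
    proof -
      have "f x = (\<Sum>i\<in>UNIV. x $ i *\<^sub>R f (axis i 1))"
        by (subst axis_expansion[of x]) (simp add: linear_sum[OF lin] linear_scale[OF lin])
      then show ?thesis using empty by (simp flip: axis_expansion)
    qed
    then show ?case by (intro exI[of _ "[]"]) auto
  next
    case (insert i T)
    have inner: "f v \<bullet> f w = v \<bullet> w" for v w
      using insert.prems by (simp add: orthogonal_transformation_def)
    show ?case
    proof (cases "f (axis i 1) = axis i 1")
      case True
      then show ?thesis using insert by (metis insert_iff)
    next
      case False
      define d where "d = f (axis i 1) - axis i 1"
      define u where "u = d /\<^sub>R norm d"
      have d: "norm d \<noteq> 0" using False by (simp add: d_def)
      then have u: "norm u = 1" by (simp add: u_def)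
      have refl: "reflect u x = x - (2 * (d \<bullet> x) / (d \<bullet> d)) *\<^sub>R d" for x
        using d by (simp add: reflect_def u_def divide_simps flip: power2_norm_eq_inner) (simp add: power2_eq_square)
      \<comment> \<open>As f e_i and e_i have the same length, the reflection subtracts exactly d
        from f e_i.\<close>
      have "f (axis i 1) \<bullet> f (axis i 1) = 1" by (simp add: inner inner_axis_axis)
      then have dd: "d \<bullet> d = 2 * (d \<bullet> f (axis i 1))"
        using inner_commute[of "axis i 1" "f (axis i 1)"]
        by (simp add: d_def inner_diff_left inner_diff_right inner_axis_axis)
      define g where "g = reflect u \<circ> f"
      have "orthogonal_transformation g"
        unfolding g_def using insert.prems(1) inner_reflect[OF u] linear_reflect
        by (intro orthogonal_transformation_compose) (simp_all add: orthogonal_transformation_def)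
      moreover have "g (axis j 1) = axis j 1" if "j \<notin> T" for j
      proof (cases "j = i")
        case True
        have "2 * (d \<bullet> f (axis i 1)) / (d \<bullet> d) = 1" unfolding dd[symmetric] using d by simp
        then have "reflect u (f (axis i 1)) = f (axis i 1) - 1 *\<^sub>R d" by (simp only: refl)
        then show ?thesis by (simp add: True g_def d_def)
      next
        case False
        then have fj: "f (axis j 1) = axis j 1" using that insert.prems by simp
        have "d \<bullet> axis j 1 = f (axis i 1) \<bullet> f (axis j 1) - axis i 1 \<bullet> (axis j 1 :: real^'n)"
          by (simp add: d_def inner_diff_left fj)
        then have "d \<bullet> axis j 1 = 0" by (simp add: inner)
        then show ?thesis by (simp add: g_def fj refl)
      qed
      ultimately obtain vs where vs: "\<forall>v\<in>set vs. norm v = 1" "g = foldr reflect vs"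
        using insert.IH by blast
      have "f = foldr reflect (u # vs)"
        by (simp add: fun_eq_iff g_def reflect_reflect[OF u] flip: vs(2))
      then show ?thesis using vs(1) u by (intro exI[of _ "u # vs"]) simp
    qed
  qed
  from this[OF assms, of UNIV] show ?thesis by simp
qed

section \<open>Clifford modules\<close>

text \<open>Operators satisfying the generator relations extend to the whole algebra, the universal
  property of the Clifford algebra. Here the extension is explicit: a basis element acts by its
  generators in increasing order.\<close>

locale clifford_module =
  fixes G :: "'n::{finite,linorder} \<Rightarrow> 's::real_vector \<Rightarrow> 's"
  assumes linear_G: "linear (G i)"
    and G_square: "G i (G i s) = - s"
    and G_anticommute: "i \<noteq> j \<Longrightarrow> G i (G j s) = - G j (G i s)"
begin

definition act_basis :: "'n set \<Rightarrow> 's \<Rightarrow> 's" where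
  "act_basis A s = foldr G (sorted_list_of_set A) s"

definition act :: "'n clifford \<Rightarrow> 's \<Rightarrow> 's" where
  "act x s = (\<Sum>A\<in>UNIV. x $ A *\<^sub>R act_basis A s)"

lemma act_basis_empty [simp]: "act_basis {} s = s"
  by (simp add: act_basis_def)

lemma act_basis_insert_less:
  assumes "\<forall>b\<in>B. i < b"
  shows "act_basis (insert i B) s = G i (act_basis B s)"
proof -
  have "i \<notin> B" using assms by blast
  moreover have "insort i (sorted_list_of_set B) = i # sorted_list_of_set B"
    using assms by (intro insort_is_Cons) (auto simp: less_imp_le)
  ultimately have "sorted_list_of_set (insert i B) = i # sorted_list_of_set B"
    by (simp add: sorted_list_of_set_insert_remove)
  then show ?thesis by (simp add: act_basis_def)
qed

lemma G_simps:
  "G i (- s) = - G i s" "G i (c *\<^sub>R s) = c *\<^sub>R G i s" "G i (s + t) = G i s + G i t"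
  using linear_G by (simp_all add: linear_neg linear_scale linear_add)

text \<open>Moving \<open>G i\<close> to its place costs one sign for each smaller generator, and
  meeting i itself gives -1; these are the pairs that \<open>cl_sign\<close> counts. The induction
  removes the smallest element j and compares it with i.\<close>

lemma G_act_basis: "G i (act_basis B s) = cl_sign {i} B *\<^sub>R act_basis (sym_diff {i} B) s"
  using finite[of B]
proof (induction B rule: finite_linorder_min_induct)
  case empty
  show ?case using act_basis_insert_less[of "{}" i s] by simp
next
  case (insert j B)
  have jB: "j \<notin> B" using insert by blast
  have sign: "cl_sign {i} (insert j B) = cl_sign {i} {j} * cl_sign {i} B"
    using cl_sign_Un(2)[of "{j}" B "{i}"] jB by simp
  consider "i < j" | "i = j" | "j < i" by fastforce
  then show ?case
  proof cases
    case 1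
    then have less: "\<forall>b\<in>insert j B. i < b" using insert.hyps by auto
    then have "{(a, b). a \<in> {i} \<and> b \<in> insert j B \<and> b \<le> a} = {}" by auto
    then have "cl_sign {i} (insert j B) = 1" unfolding cl_sign_def by (simp only:) simp
    moreover have "sym_diff {i} (insert j B) = insert i (insert j B)" using less by auto
    ultimately show ?thesis using act_basis_insert_less[OF less] by simp
  next
    case 2
    have "{(a, b). a \<in> {i} \<and> b \<in> B \<and> b \<le> a} = {}" using insert.hyps 2 by auto
    then have "cl_sign {i} B = 1" unfolding cl_sign_def by (simp only:) simp
    then have "cl_sign {i} (insert j B) = -1" using sign 2 by (simp add: cl_sign_singletons)
    moreover have "sym_diff {i} (insert j B) = B" using jB 2 by auto
    ultimately show ?thesis using 2 insert.hyps
      by (simp add: act_basis_insert_less G_square)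
  next
    case 3
    have eq: "sym_diff {i} (insert j B) = insert j (sym_diff {i} B)" using 3 jB by auto
    have "\<forall>b\<in>sym_diff {i} B. j < b" using 3 insert.hyps by auto
    then have "act_basis (insert j (sym_diff {i} B)) s = G j (act_basis (sym_diff {i} B) s)"
      by (rule act_basis_insert_less)
    moreover have "G i (G j t) = - G j (G i t)" for t using 3 by (intro G_anticommute) simp
    moreover have "cl_sign {i} (insert j B) = - cl_sign {i} B"
      using 3 by (simp add: sign cl_sign_singletons)
    ultimately show ?thesis
      using insert.IH act_basis_insert_less[OF insert.hyps(2), of s] by (simp only: eq G_simps scaleR_minus_left)
  qed
qed

lemma act_basis_act_basis: "act_basis A (act_basis B s) = cl_sign A B *\<^sub>R act_basis (sym_diff A B) s"
  using finite[of A]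
proof (induction A rule: finite_linorder_min_induct)
  case (insert i A)
  have iA: "i \<notin> A" using insert by blast
  have "{(a, b). a \<in> {i} \<and> b \<in> A \<and> b \<le> a} = {}" using insert.hyps by auto
  then have "cl_sign {i} A = 1" unfolding cl_sign_def by (simp only:) simp
  then have "cl_sign {i} (sym_diff A B) = cl_sign {i} B" by (simp only: cl_sign_sym_diff)
  moreover have "cl_sign (insert i A) B = cl_sign {i} B * cl_sign A B"
    using cl_sign_Un(1)[of "{i}" A B] iA by simp
  moreover have "sym_diff {i} (sym_diff A B) = sym_diff (insert i A) B" using iA by blast
  ultimately show ?case
    using insert.IH insert.hyps by (simp add: act_basis_insert_less G_simps G_act_basis mult.commute)
qed simp_all

lemma linear_act_basis: "linear (act_basis A)"
  using finite[of A]
proof (induction A rule: finite_linorder_min_induct)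
  case (insert i A)
  then have "act_basis (insert i A) = G i \<circ> act_basis A"
    by (auto simp: act_basis_insert_less)
  then show ?case using linear_compose[OF insert.IH linear_G[of i]] by (simp only:)
qed (auto intro!: linearI)

lemma linear_act: "linear (act x)"
  using linear_act_basis
  by (auto intro!: linearI simp: act_def linear_add linear_scale algebra_simps sum.distrib scaleR_sum_right)

lemma act_add_left: "act (x + y) s = act x s + act y s"
  by (simp add: act_def algebra_simps sum.distrib)

lemma act_scaleR_left: "act (c *\<^sub>R x) s = c *\<^sub>R act x s"
  by (simp add: act_def scaleR_sum_right)

lemma linear_act_left: "linear (\<lambda>x. act x s)"
  by (intro linearI act_add_left act_scaleR_left)

lemma act_sum_left: "act (\<Sum>i\<in>I. x i) s = (\<Sum>i\<in>I. act (x i) s)"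
  using linear_sum[OF linear_act_left] .

lemma act_axis: "act (axis A 1) s = act_basis A s"
proof -
  have "act (axis A 1) s = (\<Sum>B\<in>UNIV. if B = A then act_basis A s else 0)"
    unfolding act_def by (intro sum.cong) (auto simp: axis_def)
  then show ?thesis by simp
qed

lemma act_one [simp]: "act cl_one s = s"
  by (simp add: cl_one_def act_axis)

lemma act_vec: "act (cl_vec v) s = (\<Sum>i\<in>UNIV. v $ i *\<^sub>R G i s)"
proof -
  have "act_basis {i} s = G i s" for i using act_basis_insert_less[of "{}" i s] by simp
  then show ?thesis
    by (simp add: cl_vec_def act_sum_left act_scaleR_left act_axis)
qed

lemma act_mult: "act (cl_mult x y) s = act x (act y s)"
proof -
  have "act x (act y s) = (\<Sum>A\<in>UNIV. \<Sum>B\<in>UNIV. (x $ A * y $ B) *\<^sub>R act_basis A (act_basis B s))"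
    unfolding act_def using linear_act_basis by (simp add: linear_sum linear_scale scaleR_sum_right)
  then show ?thesis
    unfolding cl_mult_def
    by (simp add: act_sum_left act_scaleR_left act_axis act_basis_act_basis ac_simps)
qed

text \<open>The averaging identity inside the module: the operator of an even x determines the even
  coefficients of x by a formula linear in that operator. This later yields both injectivity and a
  continuous inverse.\<close>

lemma act_recover:
  assumes "cl_even x" "even (card A)"
  shows "(\<Sum>C\<in>UNIV. act (cl_mult (axis C 1) (cl_star (axis A 1))) (act x (act (cl_star (axis C 1)) s)))
    = (2 ^ CARD('n) * x $ A) *\<^sub>R s"
  using arg_cong[OF cl_average_coefficient[OF assms], of "\<lambda>x. act x s"]
  by (simp add: act_sum_left act_scaleR_left act_mult)

end

section \<open>Complexified octonions and a 16-dimensional Clifford module\<close>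

lemmas oct_coords = prod_eq_iff vec_eq_iff forall_4 oct_mult_eq oct_conj_eq oct_scale_eq
  fst_conv snd_conv quat_mult_def quat_conj_def vector_4 vector_minus_component
  vector_add_component vector_uminus_component vector_smult_component fst_add snd_add
  fst_diff snd_diff fst_uminus snd_uminus

lemma UNIV_9: "UNIV = {0, 1, 2, 3, 4, 5, 6, 7, 8 :: 9}"
  by (rule sym, rule card_subset_eq) simp_all

lemma sum_9: "(\<Sum>i\<in>(UNIV :: 9 set). f i) = f 0 + f 1 + f 2 + f 3 + f 4 + f 5 + f 6 + f 7 + f 8"
  unfolding UNIV_9 by (simp add: add.assoc)

lemma forall_9: "(\<forall>i::9. P i) \<longleftrightarrow> P 0 \<and> P 1 \<and> P 2 \<and> P 3 \<and> P 4 \<and> P 5 \<and> P 6 \<and> P 7 \<and> P 8"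
  by (metis UNIV_9 UNIV_I empty_iff insert_iff)

text \<open>\<open>complex^9\<close> is identified with \<open>\<complex> \<times> \<CC>\<^sup>C\<close>: the component 0 is the scalar, the components
  1 to 8 form the octonion \<open>w_oct\<close>.\<close>

definition w_oct :: "complex^9 \<Rightarrow> complex oct" where
  "w_oct w = (vector [w$1, w$2, w$3, w$4], vector [w$5, w$6, w$7, w$8])"

definition w_make :: "complex \<Rightarrow> complex oct \<Rightarrow> complex^9" where
  "w_make q a = (\<chi> i. if i = 0 then q else if i = 1 then fst a $ 1 else if i = 2 then fst a $ 2
    else if i = 3 then fst a $ 3 else if i = 4 then fst a $ 4 else if i = 5 then snd a $ 1
    else if i = 6 then snd a $ 2 else if i = 7 then snd a $ 3 else snd a $ 4)"

lemma w_make_nth [simp]: "w_make q a $ 0 = q" "w_oct (w_make q a) = a"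
  by (simp_all add: w_make_def w_oct_def prod_eq_iff vec_eq_iff forall_4)

lemma w_make_w_oct [simp]: "w_make (w $ 0) (w_oct w) = w"
  by (simp add: w_make_def w_oct_def vec_eq_iff forall_9)

definition wform :: "complex^9 \<Rightarrow> complex^9 \<Rightarrow> complex" where
  "wform w w' = (\<Sum>i\<in>UNIV. w $ i * w' $ i)"

definition oform :: "complex oct \<Rightarrow> complex oct \<Rightarrow> complex" where
  "oform x y = (\<Sum>i\<in>UNIV. fst x $ i * fst y $ i) + (\<Sum>i\<in>UNIV. snd x $ i * snd y $ i)"

type_synonym spinor = "complex oct \<times> complex oct"

definition sform :: "spinor \<Rightarrow> spinor \<Rightarrow> complex" where
  "sform s t = oform (fst s) (fst t) + oform (snd s) (snd t)"

definition sscale :: "complex \<Rightarrow> spinor \<Rightarrow> spinor" where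
  "sscale c s = (oct_scale c (fst s), oct_scale c (snd s))"

text \<open>\<open>sform (clif w (x\<^sub>2, x\<^sub>3)) (x\<^sub>2, x\<^sub>3)\<close> is the part of the determinant of the exceptional
  Jordan algebra that is linear in \<open>w = ((\<xi>\<^sub>2 - \<xi>\<^sub>3)/2, x\<^sub>1)\<close>.\<close>

definition clif :: "complex^9 \<Rightarrow> spinor \<Rightarrow> spinor" where
  "clif w s =
    (oct_conj (oct_mult (snd s) (w_oct w)) - oct_scale (w $ 0) (fst s),
     oct_conj (oct_mult (w_oct w) (fst s)) + oct_scale (w $ 0) (snd s))"

lemmas spinor_coords = oct_coords clif_def w_oct_def sscale_def

lemma clif_add: "clif w (s + t) = clif w s + clif w t"
  unfolding spinor_coords by (intro conjI; algebra)

lemma clif_sscale: "clif w (sscale c s) = sscale c (clif w s)"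
  unfolding spinor_coords by (intro conjI; algebra)

lemma clif_add_left: "clif (w + w') s = clif w s + clif w' s"
  unfolding spinor_coords by (intro conjI; algebra)

lemma clif_scale_left: "clif (c *s w) s = sscale c (clif w s)"
  unfolding spinor_coords by (intro conjI; algebra)

text \<open>The cross terms in \<open>w $ 0\<close> cancel. What remains are the octonion identities
  conj(a) (a b) = (a, a) b and (c a) conj(a) = (a, a) c.\<close>

lemma clif_square: "clif w (clif w s) = sscale (wform w w) s"
  unfolding spinor_coords wform_def sum_9 by (intro conjI; algebra)

lemma clif_symmetric: "sform (clif w s) t = sform s (clif w t)"
  unfolding spinor_coords sform_def oform_def sum_4 by algebra

lemma sscale_simps:
  "sscale c (s + t) = sscale c s + sscale c t" "sscale (c + d) s = sscale c s + sscale d s"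
  "sscale c (sscale d s) = sscale (c * d) s" "sscale 1 s = s" "sscale 0 s = 0"
  "sscale c 0 = 0" "sscale (- c) s = - sscale c s" "sscale c (- s) = - sscale c s"
  "sscale c (s - t) = sscale c s - sscale c t"
  by (simp_all add: sscale_def oct_scale_eq prod_eq_iff vec_eq_iff algebra_simps)

lemma scaleR_eq_sscale: "r *\<^sub>R s = sscale (of_real r) s"
  by (simp add: sscale_def oct_scale_eq prod_eq_iff vec_eq_iff) (simp add: scaleR_conv_of_real)

lemma clif_zero_left: "clif 0 s = 0"
  using clif_scale_left[of 0 0 s] by (simp add: sscale_simps)

lemma clif_expansion: "clif w s = (\<Sum>i\<in>UNIV. sscale (w $ i) (clif (axis i 1) s))"
proof -
  have *: "clif (\<Sum>i\<in>I. f i) s = (\<Sum>i\<in>I. clif (f i) s)" if "finite I" for f and I :: "9 set"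
    using that by (induction I rule: finite_induct) (simp_all add: clif_add_left clif_zero_left)
  have "w = (\<Sum>i\<in>UNIV. w $ i *s axis i 1)"
    by (simp add: vec_eq_iff axis_def if_distrib cong: if_cong)
  then show ?thesis by (metis (mono_tags, lifting) * clif_scale_left finite sum.cong)
qed

lemma wform_simps:
  "wform (v + w) x = wform v x + wform w x" "wform x (v + w) = wform x v + wform x w"
  "wform (c *s v) x = c * wform v x" "wform x (c *s v) = c * wform x v" "wform v w = wform w v"
  by (simp_all add: wform_def algebra_simps sum.distrib sum_distrib_left)

lemma clif_anticommutator: "clif v (clif w s) + clif w (clif v s) = sscale (2 * wform v w) s"
proof -
  have "clif (v + w) (clif (v + w) s) = sscale (wform (v + w) (v + w)) s" by (rule clif_square)
  also have "wform (v + w) (v + w) = wform v v + wform w w + 2 * wform v w"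
    by (simp add: wform_simps(1,2)) (simp add: wform_simps(5))
  finally show ?thesis
    by (simp add: clif_add_left clif_add clif_square sscale_simps(2) algebra_simps)
qed

section \<open>Elements associating with all octonions, and Schur's lemma for
  \<open>clif\<close>\<close>

lemma oct_conj_mult: "oct_conj (oct_mult x y) = oct_mult (oct_conj y) (oct_conj x)"
  unfolding oct_coords by (intro conjI; algebra)

lemma oct_of_1_mult: "oct_mult (oct_of 1) x = x" "oct_mult x (oct_of 1) = x" "oct_conj (oct_of 1) = oct_of 1"
  unfolding oct_coords by (simp_all add: oct_of_def axis_def quat_conj_def vec_eq_iff forall_4)

lemma oct_mult_scalar: "oct_mult x (oct_of c) = oct_scale c x"
  unfolding oct_coords by (simp add: oct_of_def axis_def)

text \<open>The pair i, j kills the half of m along e_4, on which left multiplications by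
  quaternions compose in reverse order. The pairs with e_4 make the quaternion half commute with i
  and j, so it is a scalar.\<close>

lemma oct_nucleus:
  fixes m :: "complex oct"
  assumes "\<And>a b. oct_mult (oct_mult a b) m = oct_mult a (oct_mult b m)"
  shows "m = oct_of (fst m $ 1)"
  using assms[of "(axis 2 1, 0)" "(axis 3 1, 0)"] assms[of "(axis 2 1, 0)" "(0, axis 1 1)"]
    assms[of "(axis 3 1, 0)" "(0, axis 1 1)"]
  unfolding oct_coords by (simp add: axis_def oct_of_def)

text \<open>Here the pair i, j kills the quaternion half of m, since i and j anticommute. The pairs
  with e_4 make the other half anticommute with i, j and k, so it vanishes as well.\<close>

lemma oct_opposite_nucleus:
  fixes m :: "complex oct"
  assumes "\<And>a b. oct_mult (oct_mult b a) m = oct_mult a (oct_mult b m)"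
  shows "m = 0"
  using assms[of "(axis 2 1, 0)" "(axis 3 1, 0)"] assms[of "(axis 2 1, 0)" "(0, axis 1 1)"]
    assms[of "(axis 3 1, 0)" "(0, axis 1 1)"] assms[of "(axis 4 1, 0)" "(0, axis 1 1)"]
  unfolding oct_coords by (simp add: axis_def)

text \<open>Complex linearity is stated through \<open>sscale\<close> because the product type
  carries only real scalar multiplication.\<close>

definition spinor_linear :: "(spinor \<Rightarrow> spinor) \<Rightarrow> bool" where
  "spinor_linear B \<longleftrightarrow> (\<forall>s t. B (s + t) = B s + B t) \<and> (\<forall>c s. B (sscale c s) = sscale c (B s))"

lemma spinor_linear_add: "spinor_linear B \<Longrightarrow> B (s + t) = B s + B t"
  and spinor_linear_sscale: "spinor_linear B \<Longrightarrow> B (sscale c s) = sscale c (B s)"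
  by (simp_all only: spinor_linear_def)

lemma spinor_linear_zero: "spinor_linear B \<Longrightarrow> B 0 = 0"
  unfolding spinor_linear_def by (metis sscale_simps(5))

lemma spinor_linear_sum:
  assumes "spinor_linear B"
  shows "B (\<Sum>i\<in>I. f i) = (\<Sum>i\<in>I. B (f i))"
  by (induction I rule: infinite_finite_induct)
    (simp_all add: spinor_linear_zero[OF assms] spinor_linear_add[OF assms])

lemma spinor_linear_uminus: "spinor_linear B \<Longrightarrow> B (- s) = - B s"
  unfolding spinor_linear_def by (metis sscale_simps(4,7))

lemma clif_make: "clif (w_make q a) (b, c)
   = (oct_conj (oct_mult c a) - oct_scale q b, oct_conj (oct_mult a b) + oct_scale q c)"
  by (simp add: clif_def)

lemma oct_zero [simp]: "oct_mult 0 x = 0" "oct_mult x 0 = 0" "oct_conj 0 = 0" "oct_scale c 0 = 0"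
  "oct_scale 0 x = 0" "oct_scale 1 x = x"
  by (simp_all add: oct_coords)

text \<open>The operator of the scalar coordinate is -1 on the first octonion component and 1 on the
  second, so B preserves both. Commuting with the octonion operators makes B right multiplication by
  some m on the first component, with (a b) m = a (b m); hence m is a scalar, and the second
  component follows the first.\<close>

lemma clif_commutant:
  assumes "spinor_linear B"
    and comm: "\<And>i s. B (clif (axis i 1) s) = clif (axis i 1) (B s)"
  shows "\<exists>c. \<forall>s. B s = sscale c s"
proof -
  have clif: "B (clif w s) = clif w (B s)" for w s
    by (subst (1 2) clif_expansion)
      (simp add: spinor_linear_sum[OF assms(1)] spinor_linear_sscale[OF assms(1)] comm)
  have add: "B (s + t) = B s + B t" for s t by (rule spinor_linear_add[OF assms(1)])
  define P where "P b = fst (B (b, 0))" for b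
  define Q where "Q c = snd (B (0, c))" for c
  have B1: "B (b, 0) = (P b, 0)" for b
  proof -
    have "clif (w_make 1 0) (b, 0) = - (b, 0)" by (simp add: clif_make)
    then have "- B (b, 0) = clif (w_make 1 0) (fst (B (b, 0)), snd (B (b, 0)))"
      using clif[of "w_make 1 0" "(b, 0)"] by (simp add: spinor_linear_uminus[OF assms(1), symmetric])
    then have "- snd (B (b, 0)) = snd (B (b, 0))" unfolding clif_make by (simp add: prod_eq_iff)
    then have "snd (B (b, 0)) = 0" by (simp add: prod_eq_iff vec_eq_iff)
    then show ?thesis by (simp add: P_def prod_eq_iff)
  qed
  have B2: "B (0, c) = (0, Q c)" for c
  proof -
    have "clif (w_make 1 0) (0, c) = (0, c)" by (simp add: clif_make)
    then have "B (0, c) = clif (w_make 1 0) (fst (B (0, c)), snd (B (0, c)))"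
      using clif[of "w_make 1 0" "(0, c)"] by simp
    then have "- fst (B (0, c)) = fst (B (0, c))" unfolding clif_make by (simp add: prod_eq_iff)
    then have "fst (B (0, c)) = 0" by (simp add: prod_eq_iff vec_eq_iff)
    then show ?thesis by (simp add: Q_def prod_eq_iff)
  qed
  have Q: "Q (oct_conj (oct_mult a b)) = oct_conj (oct_mult a (P b))" for a b
    using clif[of "w_make 0 a" "(b, 0)"] by (simp add: clif_make B1 B2)
  have QP: "Q (oct_conj b) = oct_conj (P b)" for b
    using Q[of "oct_of 1" b] by (simp add: oct_of_1_mult)
  have P: "P (oct_mult a b) = oct_mult a (P b)" for a b
    using Q[of a b] unfolding QP by (metis oct_conj_conj)
  define m where "m = P (oct_of 1)"
  have Pm: "P a = oct_mult a m" for a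
    using P[of a "oct_of 1"] by (simp add: m_def oct_of_1_mult)
  obtain c where c: "m = oct_of c"
    using oct_nucleus[of m] P unfolding Pm by metis
  have Ps: "P a = oct_scale c a" for a by (simp add: Pm c oct_mult_scalar)
  have Qs: "Q a = oct_scale c a" for a
  proof -
    have "Q a = oct_conj (oct_scale c (oct_conj a))" using QP[of "oct_conj a"] by (simp add: Ps oct_conj_conj)
    also have "\<dots> = oct_scale c a" unfolding oct_coords by simp
    finally show ?thesis .
  qed
  have "B (b, d) = sscale c (b, d)" for b d
    using add[of "(b, 0)" "(0, d)"] by (simp add: B1 B2 Ps Qs sscale_def)
  then show ?thesis by auto
qed

text \<open>Now B exchanges the two components. With n the image of 1 under the part N,
  anticommutation gives N x = x n and (b a) n = a (b n), which only n = 0 satisfies.\<close>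

lemma clif_anticommutant:
  assumes "spinor_linear B"
    and anti: "\<And>i s. B (clif (axis i 1) s) = - clif (axis i 1) (B s)"
  shows "B s = 0"
proof -
  have clif: "B (clif w s) = - clif w (B s)" for w s
    by (subst (1 2) clif_expansion)
      (simp add: spinor_linear_sum[OF assms(1)] spinor_linear_sscale[OF assms(1)] anti sscale_simps sum_negf)
  have add: "B (s + t) = B s + B t" for s t by (rule spinor_linear_add[OF assms(1)])
  define P where "P b = snd (B (b, 0))" for b
  define N where "N c = fst (B (0, c))" for c
  have B1: "B (b, 0) = (0, P b)" for b
  proof -
    have "clif (w_make 1 0) (b, 0) = - (b, 0)" by (simp add: clif_make)
    then have "B (b, 0) = clif (w_make 1 0) (fst (B (b, 0)), snd (B (b, 0)))"
      using clif[of "w_make 1 0" "(b, 0)"] by (simp add: spinor_linear_uminus[OF assms(1)] del: uminus_Pair)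
    then have "- fst (B (b, 0)) = fst (B (b, 0))" unfolding clif_make by (simp add: prod_eq_iff)
    then have "fst (B (b, 0)) = 0" by (simp add: prod_eq_iff vec_eq_iff)
    then show ?thesis by (simp add: P_def prod_eq_iff)
  qed
  have B2: "B (0, c) = (N c, 0)" for c
  proof -
    have "clif (w_make 1 0) (0, c) = (0, c)" by (simp add: clif_make)
    then have "- B (0, c) = clif (w_make 1 0) (fst (B (0, c)), snd (B (0, c)))"
      using arg_cong[OF clif[of "w_make 1 0" "(0, c)"], of uminus] by simp
    then have "- snd (B (0, c)) = snd (B (0, c))" unfolding clif_make by (simp add: prod_eq_iff)
    then have "snd (B (0, c)) = 0" by (simp add: prod_eq_iff vec_eq_iff)
    then show ?thesis by (simp add: N_def prod_eq_iff)
  qed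
  have N: "N (oct_conj (oct_mult a b)) = - oct_conj (oct_mult (P b) a)" for a b
    using clif[of "w_make 0 a" "(b, 0)"] by (simp add: clif_make B1 B2)
  have NP: "N (oct_conj b) = - oct_conj (P b)" for b
    using N[of "oct_of 1" b] by (simp add: oct_of_1_mult)
  have neg: "oct_mult x (- y) = - oct_mult x y" for x y :: "complex oct"
    unfolding oct_coords by simp
  have Nm: "N (oct_mult y x) = oct_mult x (N y)" for x y
    using N[of "oct_conj x" "oct_conj y"] NP[of "oct_conj y"]
    by (simp add: oct_conj_mult oct_conj_conj neg)
  have Nn: "N x = oct_mult x (N (oct_of 1))" for x
    using Nm[of "oct_of 1" x] by (simp only: oct_of_1_mult)
  have "N (oct_of 1) = 0"
  proof (rule oct_opposite_nucleus)
    fix a b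
    show "oct_mult (oct_mult b a) (N (oct_of 1)) = oct_mult a (oct_mult b (N (oct_of 1)))"
      using Nm[of b a] unfolding Nn[of "oct_mult b a"] Nn[of b] .
  qed
  then have "N x = 0" for x using Nn[of x] by simp
  moreover from this have "P x = 0" for x using NP[of x] oct_conj_conj[of "P x"] by simp
  ultimately have "B (b, d) = 0" for b d
    using add[of "(b, 0)" "(0, d)"] by (simp add: B1 B2 flip: zero_prod_def)
  then show ?thesis by (cases s) auto
qed

section \<open>The exceptional Jordan algebra under the Peirce decomposition\<close>

lemma jelem_nth:
  "jelem a b c x y z $ 1 $ 1 = oct_of a" "jelem a b c x y z $ 2 $ 2 = oct_of b" "jelem a b c x y z $ 3 $ 3 = oct_of c"
  "jelem a b c x y z $ 1 $ 2 = z" "jelem a b c x y z $ 2 $ 3 = x" "jelem a b c x y z $ 3 $ 1 = y"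
  "jelem a b c x y z $ 2 $ 1 = oct_conj z" "jelem a b c x y z $ 3 $ 2 = oct_conj x" "jelem a b c x y z $ 1 $ 3 = oct_conj y"
  by (simp_all add: jelem_def)

lemma jtr_jelem: "jtr (jelem a b c x y z) = a + b + c"
  by (simp add: jtr_def sum_3 jelem_nth oct_scalar_part_eq oct_of_def)

lemma oct_of_nth: "fst (oct_of c) $ 1 = c" "fst (oct_of c) $ 2 = 0" "fst (oct_of c) $ 3 = 0"
  "fst (oct_of c) $ 4 = 0" "snd (oct_of c) $ i = 0"
  by (simp_all add: oct_of_def axis_def)

lemma jform_jelem:
  "jform (jelem a b c x y z) (jelem a' b' c' x' y' z')
    = a * a' + b * b' + c * c' + 2 * oform x x' + 2 * oform y y' + 2 * oform z z'"
  unfolding jform_def jtr_def jmult_def omat_mult_def omat_scale_def sum_3 vec_lambda_beta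
    jelem_nth oct_scalar_part_eq vector_add_component
  by (simp add: oct_coords oct_of_nth oform_def sum_4 field_simps)

lemma omat_scale_nth: "omat_scale c X $ i $ j = oct_scale c (X $ i $ j)"
  by (simp add: omat_scale_def)

lemma oct_scale_simps:
  "oct_scale a (oct_scale b x) = oct_scale (a * b) x" "oct_scale a (x + y) = oct_scale a x + oct_scale a y"
  "oct_scale a (x - y) = oct_scale a x - oct_scale a y" "oct_scale (a + b) x = oct_scale a x + oct_scale b x"
  by (simp_all add: oct_scale_eq prod_eq_iff vec_eq_iff algebra_simps)

lemma jcross_self:
  "jcross X X = omat_mult X X - omat_scale (jtr X) X
     + omat_scale ((jtr X ^ 2 - jform X X) / 2) omat_one" for X :: "complex oct_mat"
proof -
  have two: "u + u = oct_scale 2 u" for u :: "complex oct"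
    by (simp add: oct_scale_eq prod_eq_iff vec_eq_iff)
  have "jmult X X = omat_mult X X"
    by (simp add: jmult_def vec_eq_iff[of "_ :: complex oct_mat"] vec_eq_iff[of "_ :: complex oct^3"]
       omat_scale_nth two oct_scale_simps oct_scale_eq)
  moreover have "oct_scale (1/2) (oct_scale 2 u - t - t + v) = u - t + oct_scale (1/2) v"
    for t u v :: "complex oct"
    by (simp add: oct_scale_eq prod_eq_iff vec_eq_iff algebra_simps)
  ultimately show ?thesis
    unfolding jcross_def
    by (simp add: vec_eq_iff[of "_ :: complex oct_mat"] vec_eq_iff[of "_ :: complex oct^3"]
       omat_scale_nth oct_scale_simps(1) power2_eq_square)
qed

lemma jcross_jelem:
  fixes a b c :: complex
  shows "jcross (jelem a b c x y z) (jelem a b c x y z) =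
    jelem (b * c - oform x x) (c * a - oform y y) (a * b - oform z z)
      (oct_conj (oct_mult y z) - oct_scale a x) (oct_conj (oct_mult z x) - oct_scale b y)
      (oct_conj (oct_mult x y) - oct_scale c z)"
  unfolding jcross_self jtr_jelem jform_jelem vec_eq_iff[of "_ :: complex oct_mat"]
    vec_eq_iff[of "_ :: complex oct^3"] forall_3 jelem_nth vector_add_component vector_minus_component
    omat_scale_nth omat_mult_def omat_one_def vec_lambda_beta sum_3
  unfolding oct_coords
  by (simp add: oct_of_nth oform_def sum_4 field_simps power2_eq_square)

text \<open>The form of X with its cross square contains three cubic octonion terms. They agree by
  cyclic invariance of the trilinear form, which absorbs the factor 1/3.\<close>

lemma jdet_jelem:
  fixes a b c :: complex
  shows "jdet (jelem a b c x y z) =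
    a * b * c - a * oform x x - b * oform y y - c * oform z z + 2 * oform x (oct_conj (oct_mult y z))"
proof -
  have cyc: "oform x (oct_conj (oct_mult y z)) = oform y (oct_conj (oct_mult z x))" for x y z
    unfolding oform_def sum_4 oct_coords by algebra
  have lin: "oform x (y - oct_scale d z) = oform x y - d * oform x z" for x y z d
    by (simp add: oform_def oct_scale_eq sum_4 algebra_simps)
  show ?thesis
    unfolding jdet_def jcross_jelem jform_jelem lin
    using cyc[of x y z] cyc[of y z x] by (simp add: field_simps)
qed

text \<open>With half sum p and half difference \<open>w $ 0\<close> of two diagonal entries, the
  lower minor becomes \<open>p\<^sup>2 - wform w w\<close>, in which all nine coordinates of w enter
  alike.\<close>

definition jsplit :: "complex \<Rightarrow> complex \<Rightarrow> complex^9 \<Rightarrow> spinor \<Rightarrow> complex oct_mat" where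
  "jsplit r p w s = jelem r (p + w $ 0) (p - w $ 0) (w_oct w) (fst s) (snd s)"

definition jr :: "complex oct_mat \<Rightarrow> complex" where
  "jr X = fst (X $ 1 $ 1) $ 1"
definition jp :: "complex oct_mat \<Rightarrow> complex" where
  "jp X = (fst (X $ 2 $ 2) $ 1 + fst (X $ 3 $ 3) $ 1) / 2"
definition jw :: "complex oct_mat \<Rightarrow> complex^9" where
  "jw X = w_make ((fst (X $ 2 $ 2) $ 1 - fst (X $ 3 $ 3) $ 1) / 2) (X $ 2 $ 3)"
definition js :: "complex oct_mat \<Rightarrow> spinor" where
  "js X = (X $ 3 $ 1, X $ 1 $ 2)"

lemma jsplit_proj [simp]: "jr (jsplit r p w s) = r" "jp (jsplit r p w s) = p"
  "jw (jsplit r p w s) = w" "js (jsplit r p w s) = s"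
  by (simp_all add: jr_def jp_def jw_def js_def jsplit_def jelem_nth oct_of_nth)

lemma jsplit_mem [simp]: "jsplit r p w s \<in> JC"
  unfolding jsplit_def jordan_iff_jelem by blast

lemma jsplit_inject [simp]: "jsplit r p w s = jsplit r' p' w' s' \<longleftrightarrow> r = r' \<and> p = p' \<and> w = w' \<and> s = s'"
  by (metis jsplit_proj)

lemma jsplit_surj:
  assumes "X \<in> JC"
  shows "jsplit (jr X) (jp X) (jw X) (js X) = X"
proof -
  obtain a b c x y z where X: "X = jelem a b c x y z"
    using assms jordan_iff_jelem by blast
  have "(b + c) / 2 + (b - c) / 2 = b" "(b + c) / 2 - (b - c) / 2 = c" by (simp_all add: field_simps)
  then show ?thesis unfolding X
    by (simp add: jsplit_def jr_def jp_def jw_def js_def jelem_nth oct_of_nth)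
qed

lemma jsplit_cases:
  assumes "X \<in> JC"
  obtains r p w s where "X = jsplit r p w s"
  using jsplit_surj[OF assms] by metis

lemma w_oct_simps: "w_oct (v + w) = w_oct v + w_oct w" "w_oct (c *s w) = oct_scale c (w_oct w)"
  by (simp_all add: w_oct_def oct_scale_eq prod_eq_iff vec_eq_iff forall_4)

lemma jsplit_add: "jsplit r p w s + jsplit r' p' w' s' = jsplit (r + r') (p + p') (w + w') (s + s')"
  unfolding jsplit_def omat_eq_iff forall_3 forall_4 vector_add_component jelem_nth w_oct_simps fst_add snd_add
    oct_of_nth oct_conj_eq fst_conv snd_conv quat_conj_def vector_4 vector_uminus_component
  by simp

lemma jsplit_scale: "omat_scale c (jsplit r p w s) = jsplit (c * r) (c * p) (c *s w) (sscale c s)"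
  unfolding jsplit_def omat_eq_iff forall_3 forall_4 omat_scale_nth jelem_nth w_oct_simps sscale_def oct_scale_eq
    oct_of_nth oct_conj_eq fst_conv snd_conv quat_conj_def vector_4 vector_uminus_component vector_smult_component
  by (simp add: algebra_simps)

lemma wform_w_oct: "wform v w = v $ 0 * w $ 0 + oform (w_oct v) (w_oct w)"
  by (simp add: wform_def sum_9 w_oct_def oform_def sum_4)

lemma jform_jsplit:
  "jform (jsplit r p w s) (jsplit r' p' w' s') = r * r' + 2 * p * p' + 2 * wform w w' + 2 * sform s s'"
  by (simp add: jsplit_def jform_jelem wform_w_oct sform_def algebra_simps)

lemma jdet_jsplit:
  "jdet (jsplit r p w s) = r * (p\<^sup>2 - wform w w) - p * sform s s + sform (clif w s) s"
proof -
  have "sform (clif w s) s = 2 * oform (w_oct w) (oct_conj (oct_mult (fst s) (snd s)))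
      - w $ 0 * oform (fst s) (fst s) + w $ 0 * oform (snd s) (snd s)"
    unfolding spinor_coords sform_def oform_def sum_4 by algebra
  then show ?thesis
    by (simp add: jsplit_def jdet_jelem wform_w_oct sform_def algebra_simps power2_eq_square)
qed

section \<open>Complex conjugation, \<sigma> and the Hermitian product in Peirce coordinates\<close>

definition wcnj :: "complex^9 \<Rightarrow> complex^9" where
  "wcnj w = (\<chi> i. cnj (w $ i))"

definition ocnj :: "complex oct \<Rightarrow> complex oct" where
  "ocnj = map_prod (\<lambda>m. \<chi> k. cnj (m $ k)) (\<lambda>a. \<chi> k. cnj (a $ k))"

definition scnj :: "spinor \<Rightarrow> spinor" where
  "scnj s = (ocnj (fst s), ocnj (snd s))"

lemma tau_jsplit: "tau (jsplit r p w s) = jsplit (cnj r) (cnj p) (wcnj w) (scnj s)"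
  unfolding tau_def jsplit_def omat_eq_iff forall_3 forall_4 vec_lambda_beta jelem_nth
  by (simp add: scnj_def ocnj_def wcnj_def w_oct_def oct_of_nth oct_conj_eq quat_conj_def)

lemma sigma_jsplit: "sigma_map (jsplit r p w s) = jsplit r p w (- s)"
  by (simp add: jsplit_def sigma_jelem)

lemma jherm_jsplit:
  "jherm (jsplit r p w s) (jsplit r' p' w' s') =
     cnj r * r' + 2 * cnj p * p' + 2 * wform (wcnj w) w' + 2 * sform (scnj s) s'"
  by (simp add: jherm_def tau_jsplit jform_jsplit)

lemma clif_scnj: "clif (wcnj w) (scnj s) = scnj (clif w s)"
  unfolding spinor_coords scnj_def ocnj_def wcnj_def by (simp add: quat_mult_def quat_conj_def)

section \<open>The action of the spin group\<close>

definition wreal :: "real^9 \<Rightarrow> complex^9" where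
  "wreal u = (\<chi> i. of_real (u $ i))"

definition wRe :: "complex^9 \<Rightarrow> real^9" where
  "wRe w = (\<chi> i. Re (w $ i))"

definition wIm :: "complex^9 \<Rightarrow> real^9" where
  "wIm w = (\<chi> i. Im (w $ i))"

definition wext :: "(real^9 \<Rightarrow> real^9) \<Rightarrow> complex^9 \<Rightarrow> complex^9" where
  "wext f w = wreal (f (wRe w)) + \<i> *s wreal (f (wIm w))"

lemma wreal_simps:
  "wreal (u + v) = wreal u + wreal v" "wreal (c *\<^sub>R u) = of_real c *s wreal u" "wreal (- u) = - wreal u"
  "wreal (axis i 1) = axis i 1" "wreal 0 = 0"
  by (simp_all add: wreal_def vec_eq_iff axis_def)

lemma w_decomp: "wreal (wRe w) + \<i> *s wreal (wIm w) = w"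
  by (simp add: wreal_def wRe_def wIm_def vec_eq_iff complex_eq_iff)

lemma wext_eqI: "wRe v = wRe w \<Longrightarrow> wIm v = wIm w \<Longrightarrow> v = w"
  by (simp add: wRe_def wIm_def vec_eq_iff complex_eq_iff)

lemma wRe_wIm_simps:
  "wRe (v + w) = wRe v + wRe w" "wIm (v + w) = wIm v + wIm w"
  "wRe (c *s w) = Re c *\<^sub>R wRe w - Im c *\<^sub>R wIm w" "wIm (c *s w) = Re c *\<^sub>R wIm w + Im c *\<^sub>R wRe w"
  "wRe (wreal u) = u" "wIm (wreal u) = 0" "wRe (wcnj w) = wRe w" "wIm (wcnj w) = - wIm w"
  by (simp_all add: wRe_def wIm_def wreal_def wcnj_def vec_eq_iff)

lemma wRe_wext [simp]: "wRe (wext f w) = f (wRe w)"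
  and wIm_wext [simp]: "wIm (wext f w) = f (wIm w)"
  by (simp_all add: wext_def wRe_wIm_simps)

lemma wext_simps:
  assumes "linear f"
  shows "wext f (v + w) = wext f v + wext f w" "wext f (c *s w) = c *s wext f w"
    "wext f (wcnj w) = wcnj (wext f w)" "wext f (wreal u) = wreal (f u)"
  using assms by (auto intro!: wext_eqI
    simp: wRe_wIm_simps linear_add linear_diff linear_scale linear_neg linear_0)

lemma wext_wext: "wext f (wext g w) = wext (f \<circ> g) w" "wext (\<lambda>u. u) w = w"
  by (auto intro!: wext_eqI)

lemma wform_wreal: "wform (wreal u) (wreal v) = of_real (u \<bullet> v)"
  by (simp add: wform_def wreal_def inner_vec_def)

lemma wform_axis: "wform (axis i 1) (axis j 1) = (if i = j then 1 else 0)"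
  using wform_wreal[of "axis i 1" "axis j 1"] by (simp add: wreal_simps inner_axis_axis)

lemma wform_wext:
  assumes "\<And>u v. f u \<bullet> f v = u \<bullet> v"
  shows "wform (wext f v) (wext f w) = wform v w"
proof -
  have "wform (wext f v) (wext f w) = wform (wreal (wRe v) + \<i> *s wreal (wIm v)) (wreal (wRe w) + \<i> *s wreal (wIm w))"
    unfolding wext_def wform_simps(1-4) wform_wreal assms ..
  then show ?thesis by (simp only: w_decomp)
qed

lemma clif_wext:
  assumes "spinor_linear B" "\<And>u s. B (clif (wreal u) s) = clif (wreal (f u)) (B s)"
  shows "B (clif w s) = clif (wext f w) (B s)"
proof -
  have "B (clif w s) = B (clif (wreal (wRe w) + \<i> *s wreal (wIm w)) s)" by (simp only: w_decomp)
  also have "\<dots> = clif (wext f w) (B s)"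
    unfolding wext_def clif_add_left clif_scale_left spinor_linear_add[OF assms(1)]
      spinor_linear_sscale[OF assms(1)] assms(2) ..
  finally show ?thesis .
qed

text \<open>The factor \<open>\<i>\<close> turns the positive square of \<open>clif\<close> into the negative one of the Clifford algebra.\<close>

definition spin_gen :: "9 \<Rightarrow> spinor \<Rightarrow> spinor" where
  "spin_gen i s = sscale \<i> (clif (axis i 1) s)"

lemma spinor_linear_spin_gen: "spinor_linear (spin_gen i)"
  by (simp add: spinor_linear_def spin_gen_def clif_add clif_sscale sscale_simps(1,3) mult.commute
    del: split_paired_All)

lemma linear_spinor_linear: "spinor_linear B \<Longrightarrow> linear B"
  by (intro linearI) (simp_all only: spinor_linear_add spinor_linear_sscale scaleR_eq_sscale)

interpretation spin: clifford_module spin_gen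
proof (rule clifford_module.intro)
  fix i j :: 9 and s :: spinor
  show "linear (spin_gen i)" by (rule linear_spinor_linear[OF spinor_linear_spin_gen])
  have "wform (axis i 1) (axis i 1) = 1" by (simp add: wform_axis)
  then show "spin_gen i (spin_gen i s) = - s"
    by (simp add: spin_gen_def clif_sscale clif_square sscale_simps)
  assume "i \<noteq> j"
  then have "wform (axis i 1) (axis j 1) = 0" by (simp add: wform_axis)
  then have "clif (axis i 1) (clif (axis j 1) s) + clif (axis j 1) (clif (axis i 1) s) = 0"
    using clif_anticommutator[of "axis i 1" "axis j 1" s] by (simp add: sscale_simps)
  then have "clif (axis i 1) (clif (axis j 1) s) = - clif (axis j 1) (clif (axis i 1) s)"
    by (simp only: eq_neg_iff_add_eq_0)
  then show "spin_gen i (spin_gen j s) = - spin_gen j (spin_gen i s)"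
    by (simp add: spin_gen_def clif_sscale sscale_simps)
qed

text \<open>The module theory gives real linearity only; complex scalars pass through because they
  commute with every generator.\<close>

lemma spinor_linear_act: "spinor_linear (spin.act x)"
proof -
  have 1: "foldr spin_gen is (sscale c s) = sscale c (foldr spin_gen is s)" for "is" c s
    by (induction "is") (simp_all add: spinor_linear_sscale[OF spinor_linear_spin_gen])
  have 2: "sscale c (\<Sum>i\<in>I. g i) = (\<Sum>i\<in>I. sscale c (g i))" for c g and I :: "9 set set"
    by (induction I rule: infinite_finite_induct) (simp_all add: sscale_simps)
  have "spin.act x (sscale c s) = sscale c (spin.act x s)" for c s
    unfolding spin.act_def spin.act_basis_def 2 1 scaleR_eq_sscale sscale_simps(3) by (simp only: mult.commute)
  then show ?thesis
    unfolding spinor_linear_def using linear_add[OF spin.linear_act] by blast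
qed

lemma act_cl_vec: "spin.act (cl_vec u) s = sscale \<i> (clif (wreal u) s)"
proof -
  have "sscale c (\<Sum>i\<in>I. g i) = (\<Sum>i\<in>I. sscale c (g i))" for c g and I :: "9 set"
    by (induction I rule: infinite_finite_induct) (simp_all add: sscale_simps)
  then show ?thesis
    unfolding spin.act_vec by (subst clif_expansion)
      (simp add: spin_gen_def scaleR_eq_sscale sscale_simps wreal_def mult.commute)
qed

lemma act_cl_prod_clif:
  assumes "\<forall>v\<in>set vs. norm v = 1"
  shows "spin.act (cl_prod vs) (clif (wreal u) s)
    = sscale ((-1) ^ length vs) (clif (wreal (foldr reflect vs u)) (spin.act (cl_prod vs) s))"
proof -
  let ?x = "cl_prod vs"
  have "cl_mult (cl_mult (cl_mult ?x (cl_vec u)) (cl_star ?x)) ?x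
      = cl_mult ?x (cl_vec u)"
    using cl_star_cl_prod_unit[OF assms] by (simp add: cl_mult_assoc)
  then have "cl_mult ?x (cl_vec u) = (-1) ^ length vs *\<^sub>R cl_mult (cl_vec (foldr reflect vs u)) ?x"
    unfolding cl_prod_conj[OF assms] by (simp add: cl_mult.scaleR_left)
  then have "spin.act ?x (spin.act (cl_vec u) s)
      = (-1) ^ length vs *\<^sub>R spin.act (cl_vec (foldr reflect vs u)) (spin.act ?x s)"
    by (simp add: spin.act_scaleR_left flip: spin.act_mult)
  \<comment> \<open>The scalar -\<i> cancels the factor \<i> between the action of a vector and
    \<open>clif\<close>.\<close>
  then have "sscale (- \<i>) (spin.act ?x (spin.act (cl_vec u) s))
      = sscale (- \<i>) ((-1) ^ length vs *\<^sub>R spin.act (cl_vec (foldr reflect vs u)) (spin.act ?x s))"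
    by (rule arg_cong)
  then show ?thesis
    unfolding act_cl_vec spinor_linear_sscale[OF spinor_linear_act] scaleR_eq_sscale sscale_simps(3)
    by (simp add: sscale_simps mult.left_commute[of \<i>])
qed

lemma oform_oct_scale: "oform (oct_scale c x) y = c * oform x y" "oform x (oct_scale c y) = c * oform x y"
  by (simp_all add: oform_def oct_scale_eq sum_distrib_left algebra_simps)

lemma sform_sscale: "sform (sscale c s) t = c * sform s t" "sform s (sscale c t) = c * sform s t"
  by (simp_all add: sform_def sscale_def oform_oct_scale algebra_simps)

text \<open>A unit vector acts as \<i> times a symmetric operator of square 1, so it multiplies the
  form by \<i> squared, that is by -1.\<close>

lemma sform_act_cl_prod:
  assumes "\<forall>v\<in>set vs. norm v = 1"
  shows "sform (spin.act (cl_prod vs) s) (spin.act (cl_prod vs) t) = (-1) ^ length vs * sform s t"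
  using assms
proof (induction vs)
  case (Cons v vs)
  have "wform (wreal v) (wreal v) = 1" using Cons.prems by (simp add: wform_wreal norm_eq_1)
  then have "sform (spin.act (cl_vec v) s) (spin.act (cl_vec v) t) = - sform s t" for s t
    unfolding act_cl_vec sform_sscale clif_symmetric clif_square by (simp add: sform_sscale flip: mult.assoc)
  then show ?case using Cons by (simp add: spin.act_mult)
qed simp

lemma scnj_sscale: "scnj (sscale c s) = sscale (cnj c) (scnj s)"
  by (simp add: scnj_def sscale_def ocnj_def oct_scale_eq vec_eq_iff)

lemma wcnj_wreal [simp]: "wcnj (wreal u) = wreal u"
  by (simp add: wcnj_def wreal_def vec_eq_iff)

text \<open>\<open>clif\<close> of a real vector commutes with conjugation, so each factor only
  turns its \<i> into -\<i>.\<close>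

lemma scnj_act_cl_prod: "scnj (spin.act (cl_prod vs) s) = sscale ((-1) ^ length vs) (spin.act (cl_prod vs) (scnj s))"
proof (induction vs)
  case (Cons v vs)
  have "scnj (spin.act (cl_vec v) s) = sscale (-1) (spin.act (cl_vec v) (scnj s))" for s
    unfolding act_cl_vec scnj_sscale clif_scnj[symmetric] wcnj_wreal sscale_simps(3) by simp
  then show ?case using Cons
    by (simp add: spin.act_mult spinor_linear_sscale[OF spinor_linear_act] sscale_simps)
qed (simp add: sscale_simps)

lemma Spin_act:
  assumes "x \<in> carrier Spin"
  shows "spin.act x (clif w s) = clif (wext (cl_ad x) w) (spin.act x s)"
    and "sform (spin.act x s) (spin.act x t) = sform s t"
    and "scnj (spin.act x s) = spin.act x (scnj s)"
proof -
  obtain vs where vs: "x = cl_prod vs" "even (length vs)" "\<forall>v\<in>set vs. norm v = 1"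
    using assms carrier_Spin by blast
  have "cl_vec (cl_ad x w) = cl_vec (foldr reflect vs w)" for w
    using cl_vec_cl_ad[OF assms, of w] cl_prod_conj[OF vs(3), of w] vs by simp
  then have ad: "cl_ad x = foldr reflect vs" using cl_vec_inject by blast
  have "spin.act x (clif (wreal u) s) = clif (wreal (cl_ad x u)) (spin.act x s)" for u s
    unfolding ad using act_cl_prod_clif[OF vs(3)] vs(1,2) by (simp add: sscale_simps)
  then show "spin.act x (clif w s) = clif (wext (cl_ad x) w) (spin.act x s)"
    by (rule clif_wext[OF spinor_linear_act])
  show "sform (spin.act x s) (spin.act x t) = sform s t"
    using sform_act_cl_prod[OF vs(3)] vs(1,2) by simp
  show "scnj (spin.act x s) = spin.act x (scnj s)"
    using scnj_act_cl_prod[of vs] vs(1,2) by (simp add: sscale_simps)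
qed

text \<open>The restriction to \<open>JC\<close> makes the map extensional, as membership in
  \<open>Bij JC\<close> demands.\<close>

definition spin_map :: "9 clifford \<Rightarrow> complex oct_mat \<Rightarrow> complex oct_mat" where
  "spin_map x = (\<lambda>X\<in>JC. jsplit (jr X) (jp X) (wext (cl_ad x) (jw X)) (spin.act x (js X)))"

lemma spin_map_jsplit: "spin_map x (jsplit r p w s) = jsplit r p (wext (cl_ad x) w) (spin.act x s)"
  by (simp add: spin_map_def)

lemma spin_map_mult:
  assumes "x \<in> carrier Spin" "y \<in> carrier Spin"
  shows "spin_map (cl_mult x y) = compose JC (spin_map x) (spin_map y)"
proof -
  have "cl_ad (cl_mult x y) = cl_ad x \<circ> cl_ad y" using cl_ad_mult[OF assms] by auto
  then show ?thesis
    by (auto simp: spin_map_def compose_def restrict_def spin.act_mult wext_wext)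
qed

lemma spin_map_one: "spin_map cl_one = (\<lambda>X\<in>JC. X)"
proof -
  have "cl_ad (cl_one :: 9 clifford) = (\<lambda>w. w)" by (simp add: cl_ad_def vec_eq_iff fun_eq_iff)
  then show ?thesis by (auto simp: spin_map_def restrict_def wext_wext jsplit_surj)
qed

lemma spin_map_Bij:
  assumes "x \<in> carrier Spin"
  shows "spin_map x \<in> Bij JC"
proof -
  note star = Spin_star[OF assms]
  have inv: "spin_map (cl_star x) (spin_map x X) = X" "spin_map x (spin_map (cl_star x) X) = X" if "X \<in> JC" for X
    using spin_map_mult[OF star(1) assms] spin_map_mult[OF assms star(1)] star(2,3) spin_map_one that
    by (metis compose_eq restrict_apply)+
  have closed: "spin_map y X \<in> JC" if "X \<in> JC" for X y
    using that by (simp add: spin_map_def)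
  have "bij_betw (spin_map x) JC JC"
    by (rule bij_betwI[where g = "spin_map (cl_star x)"]) (auto simp: inv closed)
  then show ?thesis by (simp add: Bij_def spin_map_def)
qed

lemma spin_map_mem:
  assumes x: "x \<in> carrier Spin"
  shows "spin_map x \<in> E6_sigma \<inter> E6_lambda"
proof -
  note lin = linear_cl_ad[of x]
  note act = spinor_linear_act[of x]
  have "spin_map x (X + Y) = spin_map x X + spin_map x Y" if "X \<in> JC" "Y \<in> JC" for X Y
    by (rule jsplit_cases[OF that(1)], rule jsplit_cases[OF that(2)])
      (simp only: spin_map_jsplit jsplit_add wext_simps[OF lin] spinor_linear_add[OF act])
  moreover have "spin_map x (omat_scale c X) = omat_scale c (spin_map x X)" if "X \<in> JC" for c X
    by (rule jsplit_cases[OF that])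
      (simp only: spin_map_jsplit jsplit_scale wext_simps[OF lin] spinor_linear_sscale[OF act])
  ultimately have "spin_map x \<in> Iso_C"
    unfolding Iso_C_def using spin_map_Bij[OF x] by blast
  moreover have "jdet (spin_map x X) = jdet X" if "X \<in> JC" for X
    using that by (auto elim!: jsplit_cases simp: spin_map_jsplit jdet_jsplit wform_wext inner_cl_ad[OF x]
        Spin_act(2)[OF x] simp flip: Spin_act(1)[OF x])
  moreover have "jherm (spin_map x X) (spin_map x Y) = jherm X Y" if "X \<in> JC" "Y \<in> JC" for X Y
    using that by (auto elim!: jsplit_cases simp: spin_map_jsplit jherm_jsplit wform_wext inner_cl_ad[OF x]
        Spin_act(2,3)[OF x] simp flip: wext_simps(3)[OF lin])
  ultimately have E6: "spin_map x \<in> E6" by (simp add: E6_def)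
  have "compose JC sigma_map (compose JC (spin_map x) sigma_map) X = spin_map x X" for X
  proof (cases "X \<in> JC")
    case True
    then show ?thesis
      by (rule jsplit_cases)
        (simp add: compose_def sigma_jsplit spin_map_jsplit spinor_linear_uminus[OF act])
  qed (simp add: compose_def spin_map_def)
  moreover have "lambda_aut (spin_map x) X = spin_map x X" for X
  proof (cases "X \<in> JC")
    case True
    then obtain r p w s where X: "X = jsplit r p w s" by (rule jsplit_cases)
    have "lambda_aut (spin_map x) X = tau (tau (spin_map x X))"
      unfolding X lambda_aut_def
      by (simp add: tau_jsplit spin_map_jsplit Spin_act(3)[OF x] wext_simps(3)[OF lin])
    then show ?thesis by (simp add: tau_tau)
  qed (simp add: lambda_aut_def spin_map_def)
  ultimately show ?thesis
    using E6 by (auto simp: E6_sigma_def E6_lambda_def)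
qed

section \<open>Automorphisms fixed by \<open>\<sigma>\<close> and \<open>\<lambda>\<close>\<close>

lemma jsplit_zero: "jsplit 0 0 0 0 = 0"
  using jsplit_add[of 0 0 0 0 0 0 0 0] by simp

lemma jsplit_diff: "jsplit r p w s - jsplit r' p' w' s' = jsplit (r - r') (p - p') (w - w') (s - s')"
  by (simp add: jsplit_add diff_eq_eq)

lemma wform_diff: "wform (v - w) x = wform v x - wform w x" "wform x (v - w) = wform x v - wform x w"
  by (simp_all add: wform_def algebra_simps sum_subtractf)

lemma wform_zero [simp]: "wform 0 w = 0" "wform w 0 = 0"
  by (simp_all add: wform_def)

lemma wform_axis_right: "wform w (axis i 1) = w $ i"
  by (simp add: wform_def axis_def if_distrib cong: if_cong)

lemma sform_zero [simp]: "sform 0 s = 0" "sform s 0 = 0"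
  by (simp_all add: sform_def oform_def)

lemma sform_add: "sform (s + t) x = sform s x + sform t x" "sform x (s + t) = sform x s + sform x t"
  by (simp_all add: sform_def oform_def algebra_simps sum.distrib)

lemma sform_diff: "sform (s - t) x = sform s x - sform t x"
  by (simp add: sform_def oform_def algebra_simps sum_subtractf)

lemma sform_uminus: "sform (- s) t = - sform s t" "sform s (- t) = - sform s t"
  and wform_uminus: "wform (- v) w = - wform v w" "wform v (- w) = - wform v w"
  by (simp_all add: sform_def oform_def wform_def sum_negf)

lemma clif_uminus: "clif (- w) s = - clif w s" "clif w (- s) = - clif w s"
  using clif_scale_left[of "- 1" w s] clif_sscale[of w "- 1" s]
  by (simp_all add: sscale_simps vec.scale_minus_left)

lemma sform_commute: "sform s t = sform t s"
  by (simp add: sform_def oform_def mult.commute)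

lemma oform_axis: "oform x (axis i 1, 0) = fst x $ i" "oform x (0, axis i 1) = snd x $ i"
  by (simp_all add: oform_def axis_def if_distrib cong: if_cong)

text \<open>A test vector of square 1 from which scalars acting on spinors are read off.\<close>

definition unit_spinor :: spinor where
  "unit_spinor = ((axis 1 1, 0), 0)"

lemma sform_unit_spinor: "sform unit_spinor unit_spinor = 1"
  unfolding unit_spinor_def
  by (simp add: sform_def oform_axis flip: zero_prod_def) (simp add: oform_def)

lemma sform_nondegenerate:
  assumes "\<And>t. sform s t = 0"
  shows "s = 0"
proof -
  have "oform (fst s) x = 0" "oform (snd s) x = 0" for x
    using assms[of "(x, 0)"] assms[of "(0, x)"] by (simp_all add: sform_def oform_def)
  then have "fst (fst s) $ i = 0 \<and> snd (fst s) $ i = 0 \<and> fst (snd s) $ i = 0 \<and> snd (snd s) $ i = 0" for i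
    using oform_axis[of "fst s" i] oform_axis[of "snd s" i] by simp
  then show ?thesis unfolding prod_eq_iff vec_eq_iff by simp
qed

text \<open>On real vectors the complex bilinear form is the Euclidean inner product, hence
  definite.\<close>

lemma real_isotropic_zero:
  assumes "wcnj v = v" "wform v v = 0"
  shows "v = 0"
proof -
  have "v = wreal (wRe v)"
    using assms(1) by (simp add: wcnj_def wreal_def wRe_def vec_eq_iff complex_eq_iff)
  then show ?thesis using assms(2) wform_wreal[of "wRe v" "wRe v"] wreal_simps(5) by auto
qed

lemma scnj_zero [simp]: "scnj 0 = 0" and wcnj_zero [simp]: "wcnj 0 = 0"
  by (simp_all add: scnj_def ocnj_def wcnj_def vec_eq_iff prod_eq_iff)

lemma spinor_self_neg: "s = - s \<Longrightarrow> s = 0" for s :: spinor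
  by (simp add: prod_eq_iff vec_eq_iff)

locale sigma_lambda_fixed =
  fixes \<alpha> :: "complex oct_mat \<Rightarrow> complex oct_mat"
  assumes mem: "\<alpha> \<in> E6_sigma \<inter> E6_lambda"
begin

lemma E6: "\<alpha> \<in> E6" and Iso: "\<alpha> \<in> Iso_C" and Bij: "\<alpha> \<in> Bij JC"
  using mem by (auto simp: E6_sigma_def E6_def Iso_C_def)

lemma bij: "bij_betw \<alpha> JC JC" and extensional: "\<alpha> \<in> extensional JC"
  using Bij by (auto simp: Bij_def)

lemma closed [simp]: "X \<in> JC \<Longrightarrow> \<alpha> X \<in> JC"
  using bij_betwE[OF bij] by simp

lemma surj:
  assumes "Y \<in> JC"
  obtains X where "X \<in> JC" "\<alpha> X = Y"
proof -
  have "Y \<in> \<alpha> ` JC" using assms bij_betw_imp_surj_on[OF bij] by simp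
  then show ?thesis using that by auto
qed

lemma add: "X \<in> JC \<Longrightarrow> Y \<in> JC \<Longrightarrow> \<alpha> (X + Y) = \<alpha> X + \<alpha> Y"
  using Iso by (simp add: Iso_C_def)

lemma scale: "X \<in> JC \<Longrightarrow> \<alpha> (omat_scale c X) = omat_scale c (\<alpha> X)"
  using Iso by (simp add: Iso_C_def)

lemma det: "X \<in> JC \<Longrightarrow> jdet (\<alpha> X) = jdet X"
  using E6 by (simp add: E6_def)

lemma sigma:
  assumes "X \<in> JC"
  shows "sigma_map (\<alpha> X) = \<alpha> (sigma_map X)"
proof -
  obtain r p w s where X: "X = jsplit r p w s" using assms by (rule jsplit_cases)
  have "compose JC sigma_map (compose JC \<alpha> sigma_map) (sigma_map X) = \<alpha> (sigma_map X)"
    using mem by (simp add: E6_sigma_def)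
  then show ?thesis by (simp add: X sigma_jsplit compose_def)
qed

lemma tau:
  assumes "X \<in> JC"
  shows "tau (\<alpha> X) = \<alpha> (tau X)"
proof -
  have "lambda_aut \<alpha> (tau X) = \<alpha> (tau X)"
    using mem by (simp add: E6_lambda_def)
  then show ?thesis using assms by (simp add: lambda_aut_def tau_jordan tau_tau)
qed

text \<open>Commuting with \<tau> turns invariance of the Hermitian product into invariance of the
  bilinear form.\<close>

lemma form:
  assumes "X \<in> JC" "Y \<in> JC"
  shows "jform (\<alpha> X) (\<alpha> Y) = jform X Y"
proof -
  have "jherm (\<alpha> (tau X)) (\<alpha> Y) = jherm (tau X) Y"
    using E6 assms by (simp add: E6_def tau_jordan)
  then show ?thesis using assms by (simp add: jherm_def tau tau_jordan tau_tau)
qed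

lemma diff: "X \<in> JC \<Longrightarrow> Y \<in> JC \<Longrightarrow> \<alpha> (X - Y) = \<alpha> X - \<alpha> Y"
proof -
  assume XY: "X \<in> JC" "Y \<in> JC"
  then have "X - Y \<in> JC" by (auto elim!: jsplit_cases simp: jsplit_diff)
  then show ?thesis using add[of "X - Y" Y] XY by simp
qed

text \<open>The elements with s = 0 form the eigenspace of \<sigma> for 1, and those with only s the
  one for -1. As \<alpha> commutes with \<sigma>, it preserves both.\<close>

lemma even_part:
  obtains r' p' w' where "\<alpha> (jsplit r p w 0) = jsplit r' p' w' 0"
proof -
  obtain r' p' w' s where eq: "\<alpha> (jsplit r p w 0) = jsplit r' p' w' s"
    using closed[OF jsplit_mem] by (rule jsplit_cases)
  have "sigma_map (\<alpha> (jsplit r p w 0)) = \<alpha> (jsplit r p w 0)"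
    by (simp add: sigma sigma_jsplit)
  then have "s = - s" unfolding eq sigma_jsplit jsplit_inject by simp
  then show ?thesis using that eq spinor_self_neg by blast
qed

lemma odd_part: "\<alpha> (jsplit 0 0 0 s) = jsplit 0 0 0 (js (\<alpha> (jsplit 0 0 0 s)))"
proof -
  obtain r p w t where eq: "\<alpha> (jsplit 0 0 0 s) = jsplit r p w t"
    using closed[OF jsplit_mem] by (rule jsplit_cases)
  have "sigma_map (\<alpha> (jsplit 0 0 0 s)) = \<alpha> (jsplit 0 0 0 (- s))"
    by (simp add: sigma sigma_jsplit)
  also have "\<alpha> (jsplit 0 0 0 (- s)) = \<alpha> (jsplit 0 0 0 0) - \<alpha> (jsplit 0 0 0 s)"
    by (simp add: jsplit_diff flip: diff)
  also have "\<alpha> (jsplit 0 0 0 0) = \<alpha> (jsplit 0 0 0 0) + \<alpha> (jsplit 0 0 0 0)"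
    by (subst add[symmetric]) (simp_all add: jsplit_add)
  then have "\<alpha> (jsplit 0 0 0 0) = jsplit 0 0 0 0" by (simp add: jsplit_zero)
  finally have "r = - r" "p = - p" "w = - w" unfolding eq sigma_jsplit by (simp_all add: jsplit_diff)
  then have "r = 0" "p = 0" "w = 0" by (simp_all add: vec_eq_iff)
  then show ?thesis by (simp add: eq)
qed

section \<open>The image of the first idempotent\<close>

definition "r0 = jr (\<alpha> (jsplit 1 0 0 0))"
definition "p0 = jp (\<alpha> (jsplit 1 0 0 0))"
definition "w0 = jw (\<alpha> (jsplit 1 0 0 0))"

lemma alpha_e1: "\<alpha> (jsplit 1 0 0 0) = jsplit r0 p0 w0 0"
  unfolding r0_def p0_def w0_def using even_part[of 1 0 0] by (metis jsplit_proj)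

lemma det_e1: "r0 * (p0\<^sup>2 - wform w0 w0) = 0"
  using det[OF jsplit_mem, of 1 0 0 0] by (simp add: alpha_e1 jdet_jsplit)

text \<open>Compares the parts of the determinant that are linear in the first idempotent.\<close>

lemma det_linear_part:
  assumes "\<alpha> (jsplit 0 p w 0) = jsplit a b v 0"
  shows "r0 * (b\<^sup>2 - wform v v) + 2 * a * (b * p0 - wform v w0) = p\<^sup>2 - wform w w"
proof -
  have "jdet (jsplit a b v 0 + jsplit r0 p0 w0 0) - jdet (jsplit a b v 0 - jsplit r0 p0 w0 0)
    = jdet (jsplit 0 p w 0 + jsplit 1 0 0 0) - jdet (jsplit 0 p w 0 - jsplit 1 0 0 0)"
    unfolding assms[symmetric] alpha_e1[symmetric] add[OF jsplit_mem jsplit_mem, symmetric]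
      diff[OF jsplit_mem jsplit_mem, symmetric]
    by (simp add: det jsplit_add jsplit_diff)
  then show ?thesis
    unfolding jsplit_add jsplit_diff jdet_jsplit wform_simps(1,2) wform_diff
    using det_e1 wform_simps(5)[of v w0] by (simp add: power2_eq_square) algebra
qed

text \<open>For the first idempotent e, the term of det (e + Y) linear in Y vanishes. Surjectivity
  of \<alpha> transfers this to the image of e, where the directions p and w give the two
  products.\<close>

lemma r0_p0_w0: "r0 * p0 = 0" "r0 * w0 $ i = 0"
proof -
  have *: "jdet (jsplit r0 p0 w0 0 + Z) - jdet (jsplit r0 p0 w0 0 - Z) = 2 * jdet Z" if Z: "Z \<in> JC" for Z
  proof -
    obtain Y where Y: "Y \<in> JC" "\<alpha> Y = Z" by (rule surj[OF Z])
    obtain r p w s where Yeq: "Y = jsplit r p w s" by (rule jsplit_cases[OF Y(1)])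
    have "jdet (jsplit 1 0 0 0 + Y) - jdet (jsplit 1 0 0 0 - Y) = 2 * jdet Y"
      unfolding Yeq jsplit_add jsplit_diff jdet_jsplit
      by (simp add: sform_uminus clif_uminus wform_uminus) algebra
    moreover have "jsplit 1 0 0 0 + Y \<in> JC" "jsplit 1 0 0 0 - Y \<in> JC"
      by (simp_all add: Yeq jsplit_add jsplit_diff)
    ultimately show ?thesis unfolding alpha_e1[symmetric] Y(2)[symmetric]
      using Y(1) by (simp add: det flip: add diff)
  qed
  show "r0 * p0 = 0"
    using *[OF jsplit_mem, of 0 1 0 0] by (simp add: jsplit_add jsplit_diff jdet_jsplit power2_eq_square algebra_simps)
  show "r0 * w0 $ i = 0"
    using *[OF jsplit_mem, of 0 0 "axis i 1" 0] wform_axis_right[of w0 i] wform_simps(5)[of "axis i 1" w0]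
    by (simp add: jsplit_add jsplit_diff jdet_jsplit wform_simps(1,2) wform_diff algebra_simps)
qed

lemma form_e1: "r0\<^sup>2 + 2 * p0\<^sup>2 + 2 * wform w0 w0 = 1"
  using form[OF jsplit_mem jsplit_mem, of 1 0 0 0 1 0 0 0]
  by (simp add: alpha_e1 jform_jsplit power2_eq_square mult.assoc)

definition "f_a i = jr (\<alpha> (jsplit 0 0 (axis i 1) 0))"
definition "f_b i = jp (\<alpha> (jsplit 0 0 (axis i 1) 0))"
definition "f_v i = jw (\<alpha> (jsplit 0 0 (axis i 1) 0))"

lemma alpha_axis: "\<alpha> (jsplit 0 0 (axis i 1) 0) = jsplit (f_a i) (f_b i) (f_v i) 0"
  unfolding f_a_def f_b_def f_v_def using even_part[of 0 0 "axis i 1"] by (metis jsplit_proj)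

lemma alpha_axis_add: "\<alpha> (jsplit 0 0 (axis i 1 + axis j 1) 0) = jsplit (f_a i + f_a j) (f_b i + f_b j) (f_v i + f_v j) 0"
proof -
  have "\<alpha> (jsplit 0 0 (axis i 1) 0 + jsplit 0 0 (axis j 1) 0)
    = jsplit (f_a i) (f_b i) (f_v i) 0 + jsplit (f_a j) (f_b j) (f_v j) 0"
    by (simp only: add[OF jsplit_mem jsplit_mem] alpha_axis)
  then show ?thesis by (simp add: jsplit_add)
qed

text \<open>Otherwise \<open>- wform w w\<close>, restricted to three coordinates, would be a product of two linear forms.\<close>

lemma r0_neq_0: "r0 \<noteq> 0"
proof
  assume r0: "r0 = 0"
  define g where "g i = 2 * (f_b i * p0 - wform (f_v i) w0)" for i
  have 1: "f_a i * g i = - 1" for i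
    using det_linear_part[OF alpha_axis, of i] r0 by (simp add: g_def wform_axis algebra_simps)
  have 2: "(f_a i + f_a j) * (g i + g j) = - 2" if "i \<noteq> j" for i j
    using det_linear_part[OF alpha_axis_add, of i j] r0 that
    by (simp add: g_def wform_axis wform_simps(1,2) algebra_simps)
  \<comment> \<open>The mixed term of two orthogonal axes vanishes, so the squares of any two
    \<open>f_a\<close> are negatives of each other; among three indices this forces a square to be
    0.\<close>
  have 3: "(f_a i)\<^sup>2 = - (f_a j)\<^sup>2" if "i \<noteq> j" for i j
  proof -
    have "f_a i * g j + f_a j * g i = 0"
      using 2[OF that] 1[of i] 1[of j] by (simp add: algebra_simps)
    then show ?thesis using 1[of i] 1[of j] by algebra
  qed
  have "(f_a 0)\<^sup>2 = 0" using 3[of 0 1] 3[of 1 2] 3[of 0 2] by simp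
  then show False using 1[of 0] by simp
qed

lemma p0: "p0 = 0" and w0: "w0 = 0"
  using r0_p0_w0 r0_neq_0 by (simp_all add: vec_eq_iff)

lemma r0_square: "r0\<^sup>2 = 1"
  using form_e1 by (simp add: p0 w0)

text \<open>The first idempotent goes to a nonzero multiple of itself, so its orthogonal complement
  is preserved.\<close>

lemma alpha_jr:
  assumes "\<alpha> (jsplit 0 p w 0) = jsplit a b v 0"
  shows "a = 0"
  using form[OF jsplit_mem jsplit_mem, of 0 p w 0 1 0 0 0] r0_neq_0
  by (simp add: assms alpha_e1 p0 w0 jform_jsplit)

lemma alpha_pw:
  assumes "\<alpha> (jsplit 0 p w 0) = jsplit a b v 0"
  shows "r0 * (b\<^sup>2 - wform v v) = p\<^sup>2 - wform w w" "b\<^sup>2 + wform v v = p\<^sup>2 + wform w w"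
proof -
  show "r0 * (b\<^sup>2 - wform v v) = p\<^sup>2 - wform w w"
    using det_linear_part[OF assms] by (simp add: p0 w0)
  have "2 * (b\<^sup>2 + wform v v) = 2 * (p\<^sup>2 + wform w w)"
    using form[OF jsplit_mem jsplit_mem, of 0 p w 0 0 p w 0] alpha_jr[OF assms]
    by (simp add: assms jform_jsplit power2_eq_square algebra_simps)
  then show "b\<^sup>2 + wform v v = p\<^sup>2 + wform w w" by (simp only: mult_cancel_left) simp
qed

text \<open>For r0 = -1 the invariants of \<open>alpha_pw\<close> combine to make
  \<open>wform w w\<close> the square of a linear form in w, which fails on two orthogonal axes and
  their sum.\<close>

lemma r0: "r0 = 1"
proof (rule ccontr)
  assume "r0 \<noteq> 1"
  then have r0: "r0 = - 1" using r0_square by (simp add: power2_eq_1_iff)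
  have *: "b\<^sup>2 = wform w w" if "\<alpha> (jsplit 0 0 w 0) = jsplit a b v 0" for w a b v
  proof -
    have "2 * b\<^sup>2 = 2 * wform w w" using alpha_pw[OF that] r0 by algebra
    then show ?thesis by simp
  qed
  have "(f_b 0)\<^sup>2 = 1" "(f_b 1)\<^sup>2 = 1" "(f_b 0 + f_b 1)\<^sup>2 = 2"
    using *[OF alpha_axis, of 0] *[OF alpha_axis, of 1] *[OF alpha_axis_add, of 0 1]
    by (simp_all add: wform_axis wform_simps(1,2))
  then have "f_b 0 * f_b 1 = 0" by (simp add: power2_eq_square algebra_simps)
  then show False using \<open>(f_b 0)\<^sup>2 = 1\<close> \<open>(f_b 1)\<^sup>2 = 1\<close> by auto
qed

lemma alpha_p_square:
  assumes "\<alpha> (jsplit 0 p w 0) = jsplit a b v 0"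
  shows "b\<^sup>2 = p\<^sup>2" "wform v v = wform w w"
proof -
  have "2 * b\<^sup>2 = 2 * p\<^sup>2" "2 * wform v v = 2 * wform w w"
    using alpha_pw[OF assms] r0 by algebra+
  then show "b\<^sup>2 = p\<^sup>2" "wform v v = wform w w" by simp_all
qed

section \<open>The induced maps on vectors and spinors\<close>

definition "A w = jw (\<alpha> (jsplit 0 0 w 0))"
definition "B s = js (\<alpha> (jsplit 0 0 0 s))"

lemma alpha_w: "\<alpha> (jsplit 0 0 w 0) = jsplit 0 0 (A w) 0"
proof -
  obtain a b v where eq: "\<alpha> (jsplit 0 0 w 0) = jsplit a b v 0" by (rule even_part)
  then show ?thesis using alpha_jr[OF eq] alpha_p_square[OF eq] by (simp add: A_def)
qed

lemma alpha_s: "\<alpha> (jsplit 0 0 0 s) = jsplit 0 0 0 (B s)"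
  using odd_part by (simp add: B_def)

lemma B_form: "sform (B s) (B t) = sform s t"
  using form[OF jsplit_mem jsplit_mem, of 0 0 0 s 0 0 0 t] by (simp add: alpha_s jform_jsplit)

text \<open>The vector component of the image is isotropic, and real because \<alpha> commutes with
  \<tau>, so it is 0. The sign of b is then fixed by the term p (s, s) of the determinant, evaluated
  at a spinor of square 1.\<close>

lemma alpha_p: "\<alpha> (jsplit 0 p 0 0) = jsplit 0 p 0 0"
proof -
  obtain a b v where eq: "\<alpha> (jsplit 0 1 0 0) = jsplit a b v 0" by (rule even_part)
  have a: "a = 0" and v: "wform v v = 0"
    using alpha_jr[OF eq] alpha_p_square[OF eq] by simp_all
  have "tau (\<alpha> (jsplit 0 1 0 0)) = \<alpha> (jsplit 0 1 0 0)" by (simp add: tau tau_jsplit)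
  then have "wcnj v = v" unfolding eq tau_jsplit by simp
  then have v0: "v = 0" using v real_isotropic_zero by blast
  let ?s = unit_spinor
  have "\<alpha> (jsplit 0 1 0 ?s) = jsplit 0 b 0 (B ?s)"
    using add[OF jsplit_mem jsplit_mem, of 0 1 0 0 0 0 0 ?s] by (simp only: eq a v0 alpha_s jsplit_add) simp
  then have "jdet (jsplit 0 b 0 (B ?s)) = jdet (jsplit 0 1 0 ?s)"
    using det[OF jsplit_mem, of 0 1 0 ?s] by simp
  then have "b = 1" by (simp only: jdet_jsplit B_form sform_unit_spinor clif_zero_left) simp
  then have "\<alpha> (omat_scale p (jsplit 0 1 0 0)) = omat_scale p (jsplit 0 1 0 0)"
    by (simp add: scale eq a v0)
  then show ?thesis by (simp add: jsplit_scale sscale_simps)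
qed

lemma alpha_r: "\<alpha> (jsplit r 0 0 0) = jsplit r 0 0 0"
  using scale[OF jsplit_mem, of r 1 0 0 0] by (simp add: alpha_e1 p0 w0 r0 jsplit_scale sscale_simps)

lemma alpha_jsplit: "\<alpha> (jsplit r p w s) = jsplit r p (A w) (B s)"
proof -
  have "\<alpha> (jsplit 0 0 w 0 + jsplit 0 0 0 s) = jsplit 0 0 (A w) (B s)"
    by (subst add) (simp_all add: alpha_w alpha_s jsplit_add)
  then have 1: "\<alpha> (jsplit 0 0 w s) = jsplit 0 0 (A w) (B s)" by (simp add: jsplit_add)
  have "\<alpha> (jsplit 0 p 0 0 + jsplit 0 0 w s) = jsplit 0 p (A w) (B s)"
    by (subst add) (simp_all add: alpha_p 1 jsplit_add)
  then have 2: "\<alpha> (jsplit 0 p w s) = jsplit 0 p (A w) (B s)" by (simp add: jsplit_add)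
  have "\<alpha> (jsplit r 0 0 0 + jsplit 0 p w s) = jsplit r p (A w) (B s)"
    by (subst add) (simp_all add: alpha_r 2 jsplit_add)
  then show ?thesis by (simp add: jsplit_add)
qed

lemma A_add: "A (v + w) = A v + A w" and A_scale: "A (c *s w) = c *s A w"
  and A_form: "wform (A v) (A w) = wform v w" and A_cnj: "wcnj (A w) = A (wcnj w)"
proof -
  show "A (v + w) = A v + A w"
    using add[OF jsplit_mem jsplit_mem, of 0 0 v 0 0 0 w 0] by (simp add: jsplit_add alpha_jsplit)
  show "A (c *s w) = c *s A w"
    using scale[OF jsplit_mem, of c 0 0 w 0] by (simp add: jsplit_scale alpha_jsplit)
  show "wform (A v) (A w) = wform v w"
    using form[OF jsplit_mem jsplit_mem, of 0 0 v 0 0 0 w 0] by (simp add: alpha_w jform_jsplit)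
  show "wcnj (A w) = A (wcnj w)"
    using tau[OF jsplit_mem, of 0 0 w 0] by (simp add: alpha_w tau_jsplit)
qed

lemma spinor_linear_B: "spinor_linear B"
  unfolding spinor_linear_def
proof (intro conjI allI)
  fix s t c
  show "B (s + t) = B s + B t"
    using add[OF jsplit_mem jsplit_mem, of 0 0 0 s 0 0 0 t] by (simp add: jsplit_add alpha_jsplit)
  show "B (sscale c s) = sscale c (B s)"
    using scale[OF jsplit_mem, of c 0 0 0 s] by (simp add: jsplit_scale alpha_jsplit)
qed

text \<open>The determinant only controls the quadratic form \<open>sform (clif w s) s\<close>. It
  can be polarized because \<open>clif w\<close> is symmetric, and nondegeneracy together with
  surjectivity of B gives the identity of operators.\<close>

lemma B_clif: "B (clif w s) = clif (A w) (B s)"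
proof -
  have diag: "sform (clif (A w) (B s)) (B s) = sform (clif w s) s" for s
    using det[OF jsplit_mem, of 0 0 w s] by (simp add: alpha_jsplit jdet_jsplit)
  have pol: "sform (clif w (s + t)) (s + t) = sform (clif w s) s + sform (clif w t) t + 2 * sform (clif w s) t" for w s t
    unfolding clif_add sform_add using clif_symmetric[of w t s] sform_commute[of t "clif w s"] by simp
  have "sform (B (clif w s) - clif (A w) (B s)) (B t) = 0" for t
  proof -
    have "2 * sform (clif (A w) (B s)) (B t) = 2 * sform (clif w s) t"
      using diag[of "s + t"] diag[of s] diag[of t] unfolding spinor_linear_add[OF spinor_linear_B] pol by simp
    then show ?thesis by (simp add: sform_diff B_form)
  qed
  moreover have "\<exists>t. B t = t'" for t'
  proof -
    obtain X where X: "X \<in> JC" "\<alpha> X = jsplit 0 0 0 t'" using surj[OF jsplit_mem] by blast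
    from X(1) obtain r p w s where "X = jsplit r p w s" by (rule jsplit_cases)
    then have "B s = t'" using X(2) by (simp add: alpha_jsplit)
    then show ?thesis by blast
  qed
  ultimately have "B (clif w s) - clif (A w) (B s) = 0"
    using sform_nondegenerate by metis
  then show ?thesis by simp
qed

lemma in_image: "\<alpha> \<in> spin_map ` carrier Spin"
proof -
  define f where "f u = wRe (A (wreal u))" for u
  have Aw: "A (wreal u) = wreal (f u)" for u
  proof -
    have "wcnj (A (wreal u)) = A (wreal u)" by (simp add: A_cnj)
    then show ?thesis by (simp add: f_def wcnj_def wreal_def wRe_def vec_eq_iff complex_eq_iff)
  qed
  have lin: "linear f"
    by (intro linearI) (simp_all add: f_def wreal_simps A_add A_scale wRe_wIm_simps)
  have "complex_of_real (f u \<bullet> f v) = complex_of_real (u \<bullet> v)" for u v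
    unfolding wform_wreal[symmetric] Aw[symmetric] A_form ..
  then have inner: "f u \<bullet> f v = u \<bullet> v" for u v by (simp only: of_real_eq_iff)
  have A: "A w = wext f w" for w
  proof -
    have "A w = A (wreal (wRe w) + \<i> *s wreal (wIm w))" by (simp only: w_decomp)
    then show ?thesis by (simp only: A_add A_scale Aw wext_def)
  qed
  have "orthogonal_transformation f" using lin inner by (simp add: orthogonal_transformation_def)
  then obtain vs where vs: "\<forall>v\<in>set vs. norm v = 1" "f = foldr reflect vs"
    using orthogonal_product_of_reflections by blast
  define x where "x = cl_prod vs"
  have star: "cl_mult (cl_star x) x = cl_one" "cl_mult x (cl_star x) = cl_one"
    unfolding x_def using cl_star_cl_prod_unit[OF vs(1)] by simp_all
  \<comment> \<open>The parity of \<open>vs\<close> is still open, so x is not yet known to lie in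
    Spin; \<open>cl_star x\<close> inverts it in either case.\<close>
  define C where "C s = spin.act (cl_star x) (B s)" for s
  have linC: "spinor_linear C"
    unfolding spinor_linear_def C_def
    by (simp only: spinor_linear_add[OF spinor_linear_B] spinor_linear_sscale[OF spinor_linear_B]
      spinor_linear_add[OF spinor_linear_act] spinor_linear_sscale[OF spinor_linear_act]) simp
  have xC: "spin.act x (C s) = B s" for s
    using spin.act_mult[of x "cl_star x" "B s"] star by (simp add: C_def)
  have C_clif: "C (clif (wreal u) s) = sscale ((-1) ^ length vs) (clif (wreal u) (C s))" for u s
  proof -
    have "B (clif (wreal u) s) = clif (wreal (f u)) (spin.act x (C s))"
      by (simp only: B_clif Aw xC)
    also have "\<dots> = sscale ((-1) ^ length vs) (sscale ((-1) ^ length vs) (clif (wreal (f u)) (spin.act x (C s))))"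
      by (simp add: sscale_simps flip: power_add)
    also have "\<dots> = sscale ((-1) ^ length vs) (spin.act x (clif (wreal u) (C s)))"
      unfolding x_def vs(2) act_cl_prod_clif[OF vs(1)] ..
    finally have "C (clif (wreal u) s) = sscale ((-1) ^ length vs) (spin.act (cl_mult (cl_star x) x) (clif (wreal u) (C s)))"
      by (simp only: C_def spinor_linear_sscale[OF spinor_linear_act] spin.act_mult)
    then show ?thesis by (simp add: star)
  qed
  \<comment> \<open>An odd number of reflections would give C = 0 and hence B = 0, although B
    preserves a nonzero form.\<close>
  have even: "even (length vs)"
  proof (rule ccontr)
    assume "odd (length vs)"
    then have "C (clif (axis i 1) s) = - clif (axis i 1) (C s)" for i s
      using C_clif[of "axis i 1" s] by (simp add: wreal_simps sscale_simps)
    from clif_anticommutant[OF linC this] have "B s = 0" for s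
      using xC[of s] spinor_linear_zero[OF spinor_linear_act] by simp
    then have "sform s t = 0" for s t using B_form[of s t] by simp
    then show False using sform_unit_spinor by simp
  qed
  then have "C (clif (axis i 1) s) = clif (axis i 1) (C s)" for i s
    using C_clif[of "axis i 1" s] by (simp add: wreal_simps sscale_simps)
  then obtain c where "C s = sscale c s" for s using clif_commutant[OF linC] by blast
  then have B: "B s = sscale c (spin.act x s)" for s
    using xC[of s] by (simp only: spinor_linear_sscale[OF spinor_linear_act])
  have x: "x \<in> carrier Spin" unfolding carrier_Spin x_def using even vs(1) by blast
  \<comment> \<open>Both B and the action of x preserve the bilinear form, in which c enters
    squared.\<close>
  have "c * c = 1"
    using B_form[of unit_spinor unit_spinor] Spin_act(2)[OF x, of unit_spinor unit_spinor]
    by (simp add: B sform_sscale sform_unit_spinor)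
  then have c: "c = 1 \<or> c = - 1" by (simp add: square_eq_1_iff)
  \<comment> \<open>Conjugation is quadratic in x, so the sign drops out.\<close>
  have ad: "cl_ad (r *\<^sub>R x) = f" if "r = 1 \<or> r = - 1" for r
  proof -
    have "cl_vec (cl_ad x w) = cl_vec (f w)" for w
      using cl_vec_cl_ad[OF x, of w] cl_prod_conj[OF vs(1), of w] even by (simp add: x_def vs(2))
    then have "cl_ad x w = f w" for w using cl_vec_inject by blast
    moreover have "cl_ad (r *\<^sub>R x) w = cl_ad x w" for w
      using that by (auto simp: cl_ad_def linear_neg[OF linear_cl_star] cl_mult.minus_left cl_mult.minus_right)
    ultimately show ?thesis by auto
  qed
  \<comment> \<open>Clifford scalars are real, so the sign c is replaced by a real number before it
    is absorbed into x.\<close>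
  obtain r where r: "r = 1 \<or> r = - 1" "c = complex_of_real r" using c by force
  have "r *\<^sub>R x \<in> carrier Spin"
  proof (cases "r = 1")
    case False
    \<comment> \<open>Two copies of a unit vector multiply to -1, so -x is again an even product of
      unit vectors.\<close>
    let ?v = "axis 0 1 :: real^9"
    have "norm ?v = 1" by simp
    moreover have "r *\<^sub>R x = cl_prod (?v # ?v # vs)"
      using False r(1) by (simp add: x_def cl_vec_square cl_mult.minus_left cl_mult.scaleR_left inner_axis_axis flip: cl_mult_assoc)
    ultimately show ?thesis unfolding carrier_Spin using even vs(1) by (intro exI[of _ "?v # ?v # vs"]) auto
  qed (use x in simp)
  moreover have "\<alpha> = spin_map (r *\<^sub>R x)"
  proof (rule extensionalityI[OF extensional])
    show "spin_map (r *\<^sub>R x) \<in> extensional JC" by (simp add: spin_map_def)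
    fix X :: "complex oct_mat"
    assume "X \<in> JC"
    then obtain r' p w s where "X = jsplit r' p w s" by (rule jsplit_cases)
    then show "\<alpha> X = spin_map (r *\<^sub>R x) X"
      by (simp add: alpha_jsplit spin_map_jsplit ad[OF r(1)] A B r(2) spin.act_scaleR_left scaleR_eq_sscale)
  qed
  ultimately show ?thesis by blast
qed

end

section \<open>The isomorphism of topological groups\<close>

lemma scaleR_eq_omat_scale: "c *\<^sub>R X = omat_scale (of_real c) X"
  unfolding vec_eq_iff[of "_ :: complex oct_mat"] vec_eq_iff[of "_ :: complex oct^3"]
  by (simp add: omat_scale_nth oct_scale_eq prod_eq_iff vec_eq_iff) (simp add: scaleR_conv_of_real)

lemma scaleR_eq_vector_smult: "c *\<^sub>R w = of_real c *s w" for w :: "complex^'n"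
  by (simp add: vec_eq_iff) (simp add: scaleR_conv_of_real)

lemma spin_map_image: "spin_map ` carrier Spin = E6_sigma \<inter> E6_lambda"
  using spin_map_mem sigma_lambda_fixed.in_image sigma_lambda_fixed.intro by blast

text \<open>The odd coefficients of a spin group element vanish, the even ones are read off from its action.\<close>

definition spin_coeff :: "(spinor \<Rightarrow> spinor) \<Rightarrow> 9 set \<Rightarrow> real" where
  "spin_coeff B A = (if even (card A) then Re (fst (fst
     (\<Sum>C\<in>UNIV. spin.act (cl_mult (axis C 1) (cl_star (axis A 1)))
       (B (spin.act (cl_star (axis C 1)) unit_spinor)))) $ 1) / 2 ^ 9 else 0)"

lemma spin_coeff_act:
  assumes "x \<in> carrier Spin"
  shows "spin_coeff (spin.act x) A = x $ A"
proof (cases "even (card A)")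
  case True
  then show ?thesis
    using spin.act_recover[OF cl_even_Spin[OF assms] True, of unit_spinor]
    by (simp add: spin_coeff_def) (simp add: unit_spinor_def)
next
  case False
  then show ?thesis using cl_even_Spin[OF assms] by (auto simp: spin_coeff_def cl_even_def)
qed

definition spin_inverse :: "(complex oct_mat \<Rightarrow> complex oct_mat) \<Rightarrow> 9 clifford" where
  "spin_inverse \<alpha> = (\<chi> A. spin_coeff (\<lambda>s. js (\<alpha> (jsplit 0 0 0 s))) A)"

lemma spin_inverse_spin_map: "x \<in> carrier Spin \<Longrightarrow> spin_inverse (spin_map x) = x"
  by (simp add: spin_inverse_def spin_map_jsplit spin_coeff_act vec_eq_iff)

lemma continuous_act: "continuous_on S (spin.act x)"
  using spin.linear_act linear_continuous_on linear_conv_bounded_linear by blast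

text \<open>Each coefficient involves only finitely many values of \<alpha>, and evaluation at a
  point is continuous for pointwise convergence.\<close>

lemma continuous_spin_inverse: "continuous_on S spin_inverse"
proof -
  have js: "continuous_on T js" for T
    unfolding js_def by (intro continuous_intros)
  have "continuous_on S (\<lambda>\<alpha>. js (\<alpha> Y))" for Y
    by (rule continuous_on_compose2[OF js[of UNIV] continuous_on_subset[OF continuous_on_product_coordinates]]) auto
  then have "continuous_on S (\<lambda>\<alpha>. spin.act x (js (\<alpha> Y)))" for x Y
    by (rule continuous_on_compose2[OF continuous_act[of UNIV]]) auto
  then have "continuous_on S (\<lambda>\<alpha>. spin_coeff (\<lambda>s. js (\<alpha> (jsplit 0 0 0 s))) A)" for A
    unfolding spin_coeff_def by (cases "even (card A)") (auto intro!: continuous_intros)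
  then show ?thesis
    unfolding spin_inverse_def by (intro continuous_on_vec_lambda)
qed

lemma continuous_spin_map: "continuous_on S spin_map"
proof (rule continuous_on_coordinatewise_then_product)
  fix X
  show "continuous_on S (\<lambda>x. spin_map x X)"
  proof (cases "X \<in> JC")
    case True
    then obtain r p w s where X: "X = jsplit r p w s" by (rule jsplit_cases)
    \<comment> \<open>Only w and s vary with x. Without the constant part, what remains is a linear
      map on a finite-dimensional space, hence continuous.\<close>
    have "linear (\<lambda>u. jsplit 0 0 (fst u) (snd u))"
      by (intro linearI) (simp_all only: fst_add snd_add fst_scaleR snd_scaleR jsplit_add add_0
        scaleR_eq_omat_scale jsplit_scale scaleR_eq_sscale scaleR_eq_vector_smult mult_zero_right)
    then have lin: "continuous_on UNIV (\<lambda>u. jsplit 0 0 (fst u) (snd u))"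
      using linear_continuous_on linear_conv_bounded_linear by blast
    have star: "continuous_on S cl_star" for S :: "9 clifford set"
      using linear_cl_star linear_continuous_on linear_conv_bounded_linear by blast
    have ad: "continuous_on S (\<lambda>x. cl_ad x u)" for u
      unfolding cl_ad_def
      by (intro continuous_on_vec_lambda continuous_intros cl_mult.continuous_on star)
    have "linear wreal" by (intro linearI) (simp_all only: wreal_simps scaleR_eq_vector_smult)
    then have wreal: "continuous_on UNIV wreal"
      using linear_continuous_on linear_conv_bounded_linear by blast
    have "continuous_on S (\<lambda>x. wreal (cl_ad x u))" for u
      by (rule continuous_on_compose2[OF wreal ad]) simp
    then have wext: "continuous_on S (\<lambda>x. wext (cl_ad x) w)"
      unfolding wext_def vector_scalar_mult_def by (intro continuous_intros continuous_on_vec_lambda)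
    have act: "continuous_on S (\<lambda>x. spin.act x s)"
      using spin.linear_act_left linear_continuous_on linear_conv_bounded_linear by blast
    have "continuous_on S (\<lambda>x. jsplit r p 0 0 + jsplit 0 0 (fst (wext (cl_ad x) w, spin.act x s)) (snd (wext (cl_ad x) w, spin.act x s)))"
      by (intro continuous_on_add continuous_on_const continuous_on_compose2[OF lin] continuous_on_Pair wext act) auto
    then show ?thesis by (simp add: X spin_map_jsplit jsplit_add)
  qed (simp add: spin_map_def)
qed

theorem theorem4p12p3:
  shows "top_group_iso ((BijGroup JC)\<lparr>carrier := E6_sigma \<inter> E6_lambda\<rparr>) (Spin :: (9 clifford) monoid)"
proof -
  let ?G = "(BijGroup JC)\<lparr>carrier := E6_sigma \<inter> E6_lambda\<rparr>"
  have hom: "spin_map \<in> hom Spin (BijGroup JC)"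
    by (rule homI) (simp_all add: BijGroup_def spin_map_Bij spin_map_mult)
  \<comment> \<open>The group axioms are obtained by viewing the carrier as the image of Spin under
    a homomorphism.\<close>
  have "group ((BijGroup JC)\<lparr>carrier := spin_map ` carrier Spin, one := spin_map \<one>\<^bsub>Spin\<^esub>\<rparr>)"
    by (rule group.hom_imp_img_group[OF group_Spin hom])
  moreover have "spin_map \<one>\<^bsub>Spin\<^esub> = \<one>\<^bsub>BijGroup JC\<^esub>"
    by (simp add: spin_map_one BijGroup_def)
  ultimately have G: "group ?G"
    by (simp add: spin_map_image BijGroup_def)
  have inj: "inj_on spin_map (carrier Spin)"
    by (rule inj_on_inverseI[of _ spin_inverse]) (rule spin_inverse_spin_map)
  have "spin_map \<in> hom Spin ?G"
    using hom spin_map_mem by (simp add: hom_def)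
  then have iso: "spin_map \<in> iso Spin ?G"
    using inj spin_map_image by (simp add: iso_def bij_betw_def)
  \<comment> \<open>The explicit formula agrees with the inverse map on the carrier and so passes
    its continuity on to it.\<close>
  have inverse: "spin_inverse \<alpha> = inv_into (carrier Spin) spin_map \<alpha>" if "\<alpha> \<in> carrier ?G" for \<alpha>
  proof -
    obtain x where "x \<in> carrier Spin" "\<alpha> = spin_map x" using \<open>\<alpha> \<in> carrier ?G\<close> spin_map_image by auto
    then show ?thesis by (simp add: spin_inverse_spin_map inv_into_f_f[OF inj])
  qed
  have "inv_into (carrier Spin) spin_map \<in> iso ?G Spin"
    by (rule group.iso_set_sym[OF group_Spin iso])
  moreover have "homeomorphism (carrier ?G) (carrier Spin) (inv_into (carrier Spin) spin_map) spin_map"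
  proof (rule homeomorphismI)
    show "continuous_on (carrier ?G) (inv_into (carrier Spin) spin_map)"
      by (rule continuous_on_eq[OF continuous_spin_inverse inverse])
    show "continuous_on (carrier Spin) spin_map" by (rule continuous_spin_map)
    show "inv_into (carrier Spin) spin_map ` carrier ?G \<subseteq> carrier Spin"
      by (auto simp flip: spin_map_image intro: inv_into_into)
    show "spin_map ` carrier Spin \<subseteq> carrier ?G" using spin_map_image by simp
    show "spin_map (inv_into (carrier Spin) spin_map \<alpha>) = \<alpha>" if "\<alpha> \<in> carrier ?G" for \<alpha>
      using that by (intro f_inv_into_f) (simp add: spin_map_image)
    show "inv_into (carrier Spin) spin_map (spin_map x) = x" if "x \<in> carrier Spin" for x
      using inv_into_f_f[OF inj that] .
  qed
  ultimately show ?thesis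
    unfolding top_group_iso_def using G group_Spin by blast
qed

end
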